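(* Let $s\geq 2$ be an integer. If $\alpha$ is a positive irrational number, then the random $s$-hypergraph $G^{s}(n,n^{-\alpha})$ obeys the Zero-One Law.
   Context: An $s$-uniform hypergraph (or $s$-hypergraph) is a pair $(V,E)$ where $V$ is a set of vertices and $E$ is a set of edges, each edge being a set of exactly $s$ elements of $V$. For $p=p(n)\in[0,1]$, $G^{s}(n,p)$ denotes the binomial random $s$-hypergraph on the vertex set $\{1,\dots,n\}$: each of the $\binom{n}{s}$ possible edges is included independently with probability $p$. First-order properties of $s$-hypergraphs are those expressed by a first-order sentence in the language with equality and one $s$-ary relation symbol, interpreted as "$x_1,\dots,x_s$ are distinct and $\{x_1,\dots,x_s\}$ is an edge", with variables ranging over vertices. A property $A$ holds almost surely if $\lim_{n\to\infty}\Pr[G^{s}(n,p(n))\models A]=1$, and almost never if $\lim_{n\to\infty}\Pr[G^{s}(n,p(n))\models A]=0$. The random $s$-hypergraph $G^{s}(n,p(n))$ obeys the Zero-One Law if every first-order property holds almost surely or almost never. *)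

theory Defs
  imports "HOL-Probability.Probability"
begin

section \<open>Uniform hypergraphs\<close>

type_synonym 'a hypergraph = "'a set \<times> 'a set set"

definition possible_edges :: "nat \<Rightarrow> 'a set \<Rightarrow> 'a set set" where
  "possible_edges s V = {e. e \<subseteq> V \<and> finite e \<and> card e = s}"

definition uniform_hypergraph :: "nat \<Rightarrow> 'a hypergraph \<Rightarrow> bool" where
  "uniform_hypergraph s H \<longleftrightarrow> snd H \<subseteq> possible_edges s (fst H)"

section \<open>First-order logic with equality and one relation symbol\<close>

text \<open>Variables are natural numbers. The argument of \<open>EdgeRel\<close> is the list of variables the
  relation symbol is applied to; \<open>has_arity s\<close> says that it always has length \<open>s\<close>.\<close>

datatype fo_formula =
    Equal nat nat
  | EdgeRel "nat list"
  | Neg fo_formula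
  | And fo_formula fo_formula
  | Exists nat fo_formula

primrec has_arity :: "nat \<Rightarrow> fo_formula \<Rightarrow> bool" where
  "has_arity s (Equal x y) \<longleftrightarrow> True"
| "has_arity s (EdgeRel xs) \<longleftrightarrow> length xs = s"
| "has_arity s (Neg \<phi>) \<longleftrightarrow> has_arity s \<phi>"
| "has_arity s (And \<phi> \<psi>) \<longleftrightarrow> has_arity s \<phi> \<and> has_arity s \<psi>"
| "has_arity s (Exists x \<phi>) \<longleftrightarrow> has_arity s \<phi>"

primrec free_vars :: "fo_formula \<Rightarrow> nat set" where
  "free_vars (Equal x y) = {x, y}"
| "free_vars (EdgeRel xs) = set xs"
| "free_vars (Neg \<phi>) = free_vars \<phi>"
| "free_vars (And \<phi> \<psi>) = free_vars \<phi> \<union> free_vars \<psi>"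
| "free_vars (Exists x \<phi>) = free_vars \<phi> - {x}"

definition fo_sentence :: "nat \<Rightarrow> fo_formula \<Rightarrow> bool" where
  "fo_sentence s \<phi> \<longleftrightarrow> has_arity s \<phi> \<and> free_vars \<phi> = {}"

primrec satisfies :: "'a hypergraph \<Rightarrow> (nat \<Rightarrow> 'a) \<Rightarrow> fo_formula \<Rightarrow> bool" where
  "satisfies H v (Equal x y) \<longleftrightarrow> v x = v y"
| "satisfies H v (EdgeRel xs) \<longleftrightarrow> distinct (map v xs) \<and> set (map v xs) \<in> snd H"
| "satisfies H v (Neg \<phi>) \<longleftrightarrow> \<not> satisfies H v \<phi>"
| "satisfies H v (And \<phi> \<psi>) \<longleftrightarrow> satisfies H v \<phi> \<and> satisfies H v \<psi>"
| "satisfies H v (Exists x \<phi>) \<longleftrightarrow> (\<exists>a\<in>fst H. satisfies H (v(x := a)) \<phi>)"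

lemma satisfies_cong:
  assumes "\<And>x. x \<in> free_vars \<phi> \<Longrightarrow> v x = w x"
  shows "satisfies H v \<phi> \<longleftrightarrow> satisfies H w \<phi>"
  using assms
proof (induction \<phi> arbitrary: v w)
  case (EdgeRel xs)
  then have "map v xs = map w xs" by simp
  then show ?case by (simp only: satisfies.simps)
next
  case (Neg \<phi>)
  have "satisfies H v \<phi> \<longleftrightarrow> satisfies H w \<phi>"
    using Neg.prems by (intro Neg.IH) simp
  then show ?case by simp
next
  case (And \<phi> \<psi>)
  have "satisfies H v \<phi> \<longleftrightarrow> satisfies H w \<phi>"
    using And.prems by (intro And.IH(1)) simp
  moreover have "satisfies H v \<psi> \<longleftrightarrow> satisfies H w \<psi>"
    using And.prems by (intro And.IH(2)) simp
  ultimately show ?case by simp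
next
  case (Exists x \<phi>)
  have "satisfies H (v(x := a)) \<phi> \<longleftrightarrow> satisfies H (w(x := a)) \<phi>" for a
    using Exists.prems by (intro Exists.IH) simp
  then show ?case by simp
qed simp

text \<open>The valuation is irrelevant for sentences, so the quantifier over valuations is harmless.\<close>

definition models :: "'a hypergraph \<Rightarrow> fo_formula \<Rightarrow> bool" where
  "models H \<phi> \<longleftrightarrow> (\<forall>v. satisfies H v \<phi>)"

lemma models_iff_satisfies:
  assumes "free_vars \<phi> = {}"
  shows "models H \<phi> \<longleftrightarrow> satisfies H v \<phi>"
proof -
  have "satisfies H w \<phi> \<longleftrightarrow> satisfies H v \<phi>" for w
    using assms by (intro satisfies_cong) simp
  then show ?thesis unfolding models_def by blast
qed

definition first_order_property :: "nat \<Rightarrow> ('a hypergraph \<Rightarrow> bool) \<Rightarrow> bool" where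
  "first_order_property s A \<longleftrightarrow>
     (\<exists>\<phi>. fo_sentence s \<phi> \<and> (\<forall>H. uniform_hypergraph s H \<longrightarrow> (A H \<longleftrightarrow> models H \<phi>)))"

section \<open>The binomial random hypergraph\<close>

definition random_hypergraph :: "nat \<Rightarrow> nat \<Rightarrow> real \<Rightarrow> nat hypergraph pmf" where
  "random_hypergraph s n p =
     map_pmf (\<lambda>X. ({1..n}, {e \<in> possible_edges s {1..n}. X e}))
       (Pi_pmf (possible_edges s {1..n}) False (\<lambda>_. bernoulli_pmf p))"

definition holds_almost_surely :: "nat \<Rightarrow> (nat \<Rightarrow> real) \<Rightarrow> (nat hypergraph \<Rightarrow> bool) \<Rightarrow> bool" where
  "holds_almost_surely s p A \<longleftrightarrow>
     (\<lambda>n. measure_pmf.prob (random_hypergraph s n (p n)) {H. A H}) \<longlonglongrightarrow> 1"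

definition holds_almost_never :: "nat \<Rightarrow> (nat \<Rightarrow> real) \<Rightarrow> (nat hypergraph \<Rightarrow> bool) \<Rightarrow> bool" where
  "holds_almost_never s p A \<longleftrightarrow>
     (\<lambda>n. measure_pmf.prob (random_hypergraph s n (p n)) {H. A H}) \<longlonglongrightarrow> 0"

definition zero_one_law :: "nat \<Rightarrow> (nat \<Rightarrow> real) \<Rightarrow> bool" where
  "zero_one_law s p \<longleftrightarrow>
     (\<forall>A. first_order_property s A \<longrightarrow> holds_almost_surely s p A \<or> holds_almost_never s p A)"

end

theory Submission
  imports Defs
begin

text \<open>The predimension of a vertex set \<open>W\<close> is \<open>|W| - \<alpha> e(W)\<close>; a pattern that adds \<open>v\<close>
  vertices and \<open>e\<close> edges to a fixed set has about \<open>n\<^sup>v p\<^sup>e\<close> copies, \<open>n\<close> to the power of the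
  increase in predimension, and \<open>\<alpha>\<close> being irrational this exponent is never \<open>0\<close> unless \<open>v = 0\<close>.
  Hence almost surely no bounded set has negative predimension, so every bounded set has a
  bounded superset \<open>A\<close> that is closed: no few vertices added to \<open>A\<close> decrease the predimension.

  The key fact is that almost surely every extension pattern of positive exponents over every
  closed \<open>A\<close> has a copy that is exact (no unexpected edges) and again closed. Let \<open>d\<close> be the
  exponent of the pattern. By Chebyshev's inequality in several independent boxes, with
  probability \<open>1 - n\<^sup>-\<^sup>M\<close> there are at least \<open>c n\<^sup>d\<close> copies over \<open>A\<close>. A copy that is not exact and
  closed lies in a bounded set of relative predimension at most \<open>d - \<epsilon>\<close>, and by submodularity
  \<open>K\<close> such copies together lie in a bounded set of relative predimension at most \<open>K (d - \<epsilon>)\<close>;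
  so the \<open>K\<close>-th moment of the number of bad copies is \<open>O(n powr (K (d - \<epsilon>)))\<close>, and \<open>c n\<^sup>d\<close> bad copies
  occur with probability \<open>O(n powr (- K \<epsilon>))\<close> only. These bounds survive the union over all \<open>A\<close>.

  Isomorphisms between closed sets of two such hypergraphs can therefore be extended back and
  forth, so any two of them satisfy the same sentences of a given complexity.\<close>

section \<open>Predimension\<close>

definition ecount :: "'a set set \<Rightarrow> 'a set \<Rightarrow> nat" where
  "ecount E W = card {e \<in> E. e \<subseteq> W}"

definition new_edges :: "'a set set \<Rightarrow> 'a set \<Rightarrow> 'a set \<Rightarrow> 'a set set" where
  "new_edges E A W = {e \<in> E. e \<subseteq> W \<and> \<not> e \<subseteq> A}"

definition predim :: "real \<Rightarrow> 'a set set \<Rightarrow> 'a set \<Rightarrow> real" where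
  "predim \<alpha> E W = real (card W) - \<alpha> * real (ecount E W)"

text \<open>A size-bounded form of the self-sufficient (strong) sets of predimension theory;
  \<open>Z\<close> may overlap \<open>A\<close>, so the bound limits the vertices added.\<close>

definition closed_upto :: "real \<Rightarrow> nat \<Rightarrow> 'a hypergraph \<Rightarrow> 'a set \<Rightarrow> bool" where
  "closed_upto \<alpha> t H A \<longleftrightarrow>
     (\<forall>Z. Z \<subseteq> fst H \<and> finite Z \<and> card Z \<le> t \<longrightarrow> predim \<alpha> (snd H) A \<le> predim \<alpha> (snd H) (A \<union> Z))"

section \<open>Additivity of edge counts and submodularity of the predimension\<close>

lemma finite_subset_edges: "finite W \<Longrightarrow> finite {e \<in> E. e \<subseteq> W}"
  by (rule finite_subset[of _ "Pow W"]) auto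

lemma finite_new_edges: "finite W \<Longrightarrow> finite (new_edges E A W)"
  unfolding new_edges_def by (rule finite_subset[of _ "Pow W"]) auto

lemma ecount_eq_add_new:
  assumes "A \<subseteq> W" "finite W"
  shows "ecount E W = ecount E A + card (new_edges E A W)"
proof -
  have "{e \<in> E. e \<subseteq> W} = {e \<in> E. e \<subseteq> A} \<union> new_edges E A W"
    using assms unfolding new_edges_def by auto
  moreover have "{e \<in> E. e \<subseteq> A} \<inter> new_edges E A W = {}"
    unfolding new_edges_def by auto
  ultimately show ?thesis
    unfolding ecount_def using assms
    by (simp add: card_Un_disjoint finite_subset_edges finite_new_edges finite_subset[OF assms])
qed

lemma predim_diff:
  assumes "A \<subseteq> W" "finite W"
  shows "predim \<alpha> E W - predim \<alpha> E A = real (card (W - A)) - \<alpha> * real (card (new_edges E A W))"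
proof -
  have "card W = card A + card (W - A)"
    using assms by (metis card_Diff_subset card_mono finite_subset le_add_diff_inverse)
  then show ?thesis
    unfolding predim_def ecount_eq_add_new[OF assms] by (simp add: algebra_simps)
qed

text \<open>An edge inside \<open>U\<close> or \<open>W\<close> lies inside the union, and an edge
  inside both lies inside the intersection. The inequality is strict exactly when some edge of the
  union crosses between \<open>U - W\<close> and \<open>W - U\<close>.\<close>

lemma ecount_supermodular:
  assumes "finite U" "finite W"
  shows "ecount E U + ecount E W \<le> ecount E (U \<union> W) + ecount E (U \<inter> W)"
proof -
  have "ecount E U + ecount E W
      = card ({e \<in> E. e \<subseteq> U} \<union> {e \<in> E. e \<subseteq> W}) + card ({e \<in> E. e \<subseteq> U} \<inter> {e \<in> E. e \<subseteq> W})"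
    unfolding ecount_def using assms by (intro card_Un_Int finite_subset_edges)
  also have "\<dots> \<le> ecount E (U \<union> W) + ecount E (U \<inter> W)"
    unfolding ecount_def using assms
    by (intro add_mono card_mono finite_subset_edges) auto
  finally show ?thesis .
qed

lemma predim_submodular:
  assumes "finite U" "finite W" "0 \<le> \<alpha>"
  shows "predim \<alpha> E (U \<union> W) + predim \<alpha> E (U \<inter> W) \<le> predim \<alpha> E U + predim \<alpha> E W"
proof -
  have "card (U \<union> W) + card (U \<inter> W) = card U + card W"
    using assms card_Un_Int[of U W] by simp
  then have "real (card (U \<union> W)) + real (card (U \<inter> W)) = real (card U) + real (card W)"
    by linarith
  moreover have "\<alpha> * real (ecount E U + ecount E W)
      \<le> \<alpha> * real (ecount E (U \<union> W) + ecount E (U \<inter> W))"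
    using ecount_supermodular[OF assms(1,2), of E] assms(3) by (intro mult_left_mono) linarith+
  ultimately show ?thesis
    unfolding predim_def by (simp add: algebra_simps)
qed

lemma closed_upto_mono:
  "closed_upto \<alpha> t H A \<Longrightarrow> t' \<le> t \<Longrightarrow> closed_upto \<alpha> t' H A"
  unfolding closed_upto_def by auto

text \<open>This is where irrationality enters: with \<open>e > 0\<close> a zero exponent would make
  \<alpha> the quotient of \<open>v\<close> by \<open>e\<close>, and with \<open>e = 0\<close> it
  says \<open>v = 0\<close> outright.\<close>

lemma irrational_no_zero:
  fixes v e :: nat
  assumes "\<alpha> \<notin> \<rat>" "real v - \<alpha> * real e = 0"
  shows "v = 0"
proof (cases "e = 0")
  case False
  then have "\<alpha> = real v / real e" using assms(2) by (simp add: field_simps)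
  then have "\<alpha> \<in> \<rat>" by simp
  then show ?thesis using assms(1) by simp
qed (use assms in simp)

text \<open>Only finitely many pairs \<open>(v, e)\<close> with \<open>v \<le> N\<close> have an
  exponent between \<open>d - 1\<close> and \<open>d\<close>, because \<alpha> > 0 bounds
  \<open>e\<close> there. Hence the exponents below \<open>d\<close> stay away from \<open>d\<close>
  uniformly.\<close>

lemma predim_gap:
  fixes d \<alpha> :: real
  assumes "\<alpha> > 0"
  obtains \<epsilon> where "0 < \<epsilon>"
    "\<And>v e :: nat. v \<le> N \<Longrightarrow> real v - \<alpha> * real e < d \<Longrightarrow> real v - \<alpha> * real e \<le> d - \<epsilon>"
proof -
  define S where "S = {(v :: nat, e :: nat). v \<le> N \<and> real v - \<alpha> * real e < d \<and> d - 1 \<le> real v - \<alpha> * real e}"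
  have "S \<subseteq> {..N} \<times> {..nat \<lceil>(real N - d + 1) / \<alpha>\<rceil>}"
  proof (clarify, simp add: S_def, elim conjE)
    fix v e :: nat
    assume *: "v \<le> N" "d - 1 \<le> real v - \<alpha> * real e"
    then have "\<alpha> * real e \<le> real N - d + 1" by linarith
    then have "real e \<le> (real N - d + 1) / \<alpha>" using assms by (simp add: field_simps)
    then show "e \<le> nat \<lceil>(real N - d + 1) / \<alpha>\<rceil>" by linarith
  qed
  then have fin: "finite S" by (rule finite_subset) auto
  \<comment> \<open>Inserting \<open>1\<close> keeps the minimum defined when \<open>S\<close> is
    empty and gives \<open>\<epsilon> \<le> 1\<close>, which settles the exponents below
    \<open>d - 1\<close>.\<close>
  define \<epsilon> where "\<epsilon> = Min (insert 1 ((\<lambda>(v, e). d - (real v - \<alpha> * real e)) ` S))"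
  have "\<epsilon> \<le> 1" unfolding \<epsilon>_def using fin by (intro Min_le) auto
  have "0 < \<epsilon>" unfolding \<epsilon>_def using fin by (subst Min_gr_iff) (auto simp: S_def)
  moreover have "real v - \<alpha> * real e \<le> d - \<epsilon>" if "v \<le> N" "real v - \<alpha> * real e < d" for v e :: nat
  proof (cases "d - 1 \<le> real v - \<alpha> * real e")
    case True
    then have "(v, e) \<in> S" using that by (auto simp: S_def)
    then have "\<epsilon> \<le> d - (real v - \<alpha> * real e)"
      unfolding \<epsilon>_def using fin by (intro Min_le) force+
    then show ?thesis by simp
  next
    case False
    then show ?thesis using \<open>\<epsilon> \<le> 1\<close> by linarith
  qed
  ultimately show thesis using that by blast
qed

text \<open>Minimise predimension plus a small penalty \<open>\<eta>\<close> per vertex over the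
  supersets of \<open>X\<close> of size at most \<open>L\<close>. An enlargement by at most
  \<open>t\<close> vertices that lowers the predimension lowers it by at least
  \<open>\<epsilon>\<close> but costs at most \<open>\<eta> * t < \<epsilon>\<close>, against
  minimality. Nonnegative predimension turns the penalty into a size bound for the
  minimiser.\<close>

lemma closed_hull:
  fixes \<alpha> :: real
  assumes "\<alpha> > 0"
  obtains \<kappa> L where
    "\<And>(H :: 'a hypergraph) X. finite (fst H) \<Longrightarrow> X \<subseteq> fst H \<Longrightarrow> card X \<le> r \<Longrightarrow>
       (\<And>W. W \<subseteq> fst H \<Longrightarrow> card W \<le> L \<Longrightarrow> 0 \<le> predim \<alpha> (snd H) W) \<Longrightarrow>
       \<exists>C. X \<subseteq> C \<and> C \<subseteq> fst H \<and> card C \<le> \<kappa> \<and> closed_upto \<alpha> t H C"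
proof -
  obtain \<epsilon> where \<epsilon>: "0 < \<epsilon>" "\<And>v e :: nat. v \<le> t \<Longrightarrow> real v - \<alpha> * real e < 0 \<Longrightarrow> real v - \<alpha> * real e \<le> 0 - \<epsilon>"
    using predim_gap[OF assms, of t 0] by metis
  define \<eta> where "\<eta> = \<epsilon> / (real t + 1)"
  have \<eta>: "0 < \<eta>" "\<eta> * real t < \<epsilon>" using \<epsilon>(1) by (auto simp: \<eta>_def field_simps)
  \<comment> \<open>The quotient bounds the size of the minimiser, and the maximum with
    \<open>r\<close> makes \<open>X\<close> a competitor. The extra \<open>t\<close> in
    \<open>L\<close> keeps \<open>C \<union> Z\<close> among the competitors.\<close>
  define \<kappa> where "\<kappa> = max r (nat \<lceil>(real r + \<eta> * real r) / \<eta>\<rceil>)"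
  define L where "L = \<kappa> + t"
  have "\<exists>C. X \<subseteq> C \<and> C \<subseteq> fst H \<and> card C \<le> \<kappa> \<and> closed_upto \<alpha> t H C"
    if fin: "finite (fst H)" and X: "X \<subseteq> fst H" "card X \<le> r"
      and nonneg: "\<And>W. W \<subseteq> fst H \<Longrightarrow> card W \<le> L \<Longrightarrow> 0 \<le> predim \<alpha> (snd H) W"
    for H :: "'a hypergraph" and X
  proof -
    define pot where "pot W = predim \<alpha> (snd H) W + \<eta> * real (card W)" for W
    define F where "F = {W. X \<subseteq> W \<and> W \<subseteq> fst H \<and> card W \<le> L}"
    have "finite F" unfolding F_def by (rule finite_subset[of _ "Pow (fst H)"]) (use fin in auto)
    moreover have XF: "X \<in> F" unfolding F_def L_def \<kappa>_def using X by auto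
    ultimately obtain C where C: "C \<in> F" "\<And>W. W \<in> F \<Longrightarrow> pot C \<le> pot W"
      using ex_min_if_finite[of "pot ` F"] by (fastforce simp: not_less)
    have finC: "finite C" using C(1) fin finite_subset unfolding F_def by auto
    have "predim \<alpha> (snd H) X \<le> real r"
      unfolding predim_def using X(2) assms
      by (smt (verit, best) mult_nonneg_nonneg of_nat_0_le_iff of_nat_mono)
    then have "pot X \<le> real r + \<eta> * real r"
      unfolding pot_def using X(2) \<eta>(1) by (intro add_mono mult_left_mono) auto
    then have "pot C \<le> real r + \<eta> * real r" using C(2)[OF XF] by linarith
    moreover have "0 \<le> predim \<alpha> (snd H) C" using C(1) nonneg unfolding F_def by auto
    ultimately have "\<eta> * real (card C) \<le> real r + \<eta> * real r" unfolding pot_def by linarith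
    then have "real (card C) \<le> (real r + \<eta> * real r) / \<eta>"
      using \<eta>(1) by (simp add: field_simps)
    then have card: "card C \<le> \<kappa>" unfolding \<kappa>_def by linarith
    have "closed_upto \<alpha> t H C"
      unfolding closed_upto_def
    proof (intro allI impI, rule ccontr)
      fix Z assume Z: "Z \<subseteq> fst H \<and> finite Z \<and> card Z \<le> t" "\<not> predim \<alpha> (snd H) C \<le> predim \<alpha> (snd H) (C \<union> Z)"
      have cd: "card (C \<union> Z - C) \<le> t"
        using Z(1) card_mono[of Z "C \<union> Z - C"] by (meson Diff_subset_conv le_trans subset_refl)
      have fCZ: "finite (C \<union> Z)" using Z(1) finC by auto
      have "predim \<alpha> (snd H) (C \<union> Z) - predim \<alpha> (snd H) C \<le> 0 - \<epsilon>"
        using \<epsilon>(2)[OF cd, of "card (new_edges (snd H) C (C \<union> Z))"] Z(2)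
        unfolding predim_diff[OF Un_upper1 fCZ, symmetric] by linarith
      moreover have le: "card (C \<union> Z) \<le> card C + t"
        using card_Un_le[of C Z] Z(1) by linarith
      then have "\<eta> * real (card (C \<union> Z)) \<le> \<eta> * (real (card C) + real t)"
        using \<eta>(1) by (intro mult_left_mono) linarith+
      ultimately have "pot (C \<union> Z) < pot C"
        unfolding pot_def using \<eta>(2) by (simp add: algebra_simps)
      moreover have "C \<union> Z \<in> F" using C(1) Z(1) le card unfolding F_def L_def by auto
      ultimately show False using C(2) by force
    qed
    then show ?thesis using C(1) card unfolding F_def by blast
  qed
  then show thesis using that by blast
qed

section \<open>Random subsets\<close>

definition random_subset :: "'e set \<Rightarrow> real \<Rightarrow> 'e set pmf" where
  "random_subset E p = map_pmf (\<lambda>X. {e \<in> E. X e}) (Pi_pmf E False (\<lambda>_. bernoulli_pmf p))"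

lemma random_hypergraph_eq:
  "random_hypergraph s n p = map_pmf (\<lambda>F. ({1..n}, F)) (random_subset (possible_edges s {1..n}) p)"
  by (simp add: random_hypergraph_def random_subset_def pmf.map_comp o_def)

lemma set_random_subset: "set_pmf (random_subset E p) \<subseteq> Pow E"
  unfolding random_subset_def by auto

lemma finite_set_random_subset: "finite E \<Longrightarrow> finite (set_pmf (random_subset E p))"
  by (rule finite_subset[OF set_random_subset]) simp

lemma prob_random_subset_superset:
  assumes "finite E" "F \<subseteq> E" "0 \<le> p" "p \<le> 1"
  shows "measure_pmf.prob (random_subset E p) {H. F \<subseteq> H} = p ^ card F"
proof -
  have "(\<lambda>X. {e \<in> E. X e}) -` {H. F \<subseteq> H} = Pi E (\<lambda>e. if e \<in> F then {True} else UNIV)"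
    using assms(2) by (auto simp: Pi_def split: if_splits)
  then have "measure_pmf.prob (random_subset E p) {H. F \<subseteq> H}
      = (\<Prod>e\<in>E. measure_pmf.prob (bernoulli_pmf p) (if e \<in> F then {True} else UNIV))"
    unfolding random_subset_def measure_map_pmf by (simp add: measure_Pi_pmf_Pi assms)
  also have "\<dots> = (\<Prod>e\<in>E. if e \<in> F then p else 1)"
    using assms by (intro prod.cong) (auto simp: measure_pmf_single)
  also have "\<dots> = p ^ card F"
    using assms by (simp add: prod.If_cases Int_absorb1)
  finally show ?thesis .
qed

lemma prob_random_subset_superset_le:
  assumes "finite E" "0 \<le> p" "p \<le> 1"
  shows "measure_pmf.prob (random_subset E p) {H. F \<subseteq> H} \<le> p ^ card F"
proof (cases "F \<subseteq> E")
  case False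
  then have "set_pmf (random_subset E p) \<inter> {H. F \<subseteq> H} = {}"
    using set_random_subset[of E p] by blast
  then have "measure_pmf.prob (random_subset E p) {H. F \<subseteq> H} = 0"
    by (simp add: measure_pmf_zero_iff)
  then show ?thesis using assms by simp
qed (use prob_random_subset_superset assms in force)

lemma random_subset_union:
  assumes "finite D" "finite D'" "D \<inter> D' = {}"
  shows "random_subset (D \<union> D') p
       = map_pmf (\<lambda>(a, b). a \<union> b) (pair_pmf (random_subset D p) (random_subset D' p))"
  unfolding random_subset_def Pi_pmf_union[OF assms] map_pair[symmetric] pmf.map_comp
  by (intro map_pmf_cong refl) (use assms in \<open>auto simp: fun_eq_iff\<close>)

text \<open>The random set splits into independent parts over \<open>D\<close> and
  \<open>E - D\<close>. \<open>P\<close> reads only the first part; \<open>Q\<close> reads only the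
  second, because \<open>D'\<close> is disjoint from \<open>D\<close>.\<close>

lemma prob_random_subset_indep:
  assumes fin: "finite E" and D: "D \<subseteq> E" "D \<inter> D' = {}"
    and P: "\<And>H. P H \<longleftrightarrow> P (H \<inter> D)" and Q: "\<And>H. Q H \<longleftrightarrow> Q (H \<inter> D')"
  shows "measure_pmf.prob (random_subset E p) {H. P H \<and> Q H}
       = measure_pmf.prob (random_subset E p) {H. P H} * measure_pmf.prob (random_subset E p) {H. Q H}"
proof -
  let ?A = "random_subset D p" and ?B = "random_subset (E - D) p"
  have finD: "finite D" using fin D finite_subset by blast
  have E: "random_subset E p = map_pmf (\<lambda>(a, b). a \<union> b) (pair_pmf ?A ?B)"
    using random_subset_union[of D "E - D" p] finD fin D by (simp add: Un_absorb1)
  \<comment> \<open>Stated for arbitrary \<open>R\<close> and \<open>S\<close>, so that replacing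
    one of them by a trivially true event also yields the two marginal probabilities.\<close>
  have *: "measure_pmf.prob (random_subset E p) {H. R H \<and> S H}
      = measure_pmf.prob ?A {H. R H} * measure_pmf.prob ?B {H. S H}"
    if R: "\<And>H. R H \<longleftrightarrow> R (H \<inter> D)" and S: "\<And>H. S H \<longleftrightarrow> S (H \<inter> D')" for R S
  proof -
    have sup: "a \<subseteq> D" "b \<subseteq> E - D" if "a \<in> set_pmf ?A" "b \<in> set_pmf ?B" for a b
      using that set_random_subset by blast+
    have "R (a \<union> b) = R a" "S (a \<union> b) = S b" if "a \<in> set_pmf ?A" "b \<in> set_pmf ?B" for a b
    proof -
      have "(a \<union> b) \<inter> D = a \<inter> D" using sup[OF that] by auto
      then show "R (a \<union> b) = R a" using R[of "a \<union> b"] R[of a] by simp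
      have "(a \<union> b) \<inter> D' = b \<inter> D'" using sup[OF that] D by auto
      then show "S (a \<union> b) = S b" using S[of "a \<union> b"] S[of b] by simp
    qed
    then have eq: "set_pmf (pair_pmf ?A ?B) \<inter> (\<lambda>(a, b). a \<union> b) -` {H. R H \<and> S H}
        = (set_pmf ?A \<inter> {H. R H}) \<times> (set_pmf ?B \<inter> {H. S H})"
      by auto
    have "measure_pmf.prob (random_subset E p) {H. R H \<and> S H}
       = measure_pmf.prob (pair_pmf ?A ?B) ((\<lambda>(a, b). a \<union> b) -` {H. R H \<and> S H})"
      unfolding E measure_map_pmf ..
    also have "\<dots> = measure_pmf.prob (pair_pmf ?A ?B)
        (set_pmf (pair_pmf ?A ?B) \<inter> (\<lambda>(a, b). a \<union> b) -` {H. R H \<and> S H})"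
      by (subst Int_commute, rule measure_Int_set_pmf[symmetric])
    also have "\<dots> = measure_pmf.prob ?A (set_pmf ?A \<inter> {H. R H}) * measure_pmf.prob ?B (set_pmf ?B \<inter> {H. S H})"
      unfolding eq by (intro measure_pmf_prob_product) (auto intro: countable_subset[OF Int_lower1])
    also have "\<dots> = measure_pmf.prob ?A {H. R H} * measure_pmf.prob ?B {H. S H}"
      by (simp only: Int_commute[of "set_pmf _"] measure_Int_set_pmf)
    finally show ?thesis .
  qed
  have "measure_pmf.prob (random_subset E p) {H. P H} = measure_pmf.prob ?A {H. P H}"
    using *[of P "\<lambda>_. True"] P by simp
  moreover have "measure_pmf.prob (random_subset E p) {H. Q H} = measure_pmf.prob ?B {H. Q H}"
    using *[of "\<lambda>_. True" Q] Q by simp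
  ultimately show ?thesis using *[of P Q] P Q by simp
qed

lemma prob_random_subset_indep_power:
  assumes fin: "finite E" and D: "\<And>i. i < M \<Longrightarrow> D i \<subseteq> E"
    and disj: "\<And>i j. i < M \<Longrightarrow> j < M \<Longrightarrow> i \<noteq> j \<Longrightarrow> D i \<inter> D j = {}"
    and P: "\<And>i H. i < M \<Longrightarrow> P i H \<longleftrightarrow> P i (H \<inter> D i)"
    and q: "\<And>i. i < M \<Longrightarrow> measure_pmf.prob (random_subset E p) {H. P i H} \<le> q"
  shows "measure_pmf.prob (random_subset E p) {H. \<forall>i<M. P i H} \<le> q ^ M"
  using D disj P q
proof (induction M)
  case (Suc M)
  have "{H. \<forall>i<Suc M. P i H} = {H. P M H \<and> (\<forall>i<M. P i H)}"
    by (auto simp: less_Suc_eq)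
  moreover have "measure_pmf.prob (random_subset E p) {H. P M H \<and> (\<forall>i<M. P i H)}
    = measure_pmf.prob (random_subset E p) {H. P M H} * measure_pmf.prob (random_subset E p) {H. \<forall>i<M. P i H}"
  proof (rule prob_random_subset_indep[OF fin, where D = "D M" and D' = "\<Union>i<M. D i"])
    show "D M \<inter> (\<Union>i<M. D i) = {}" using Suc.prems(2)[of M] by (auto simp: less_Suc_eq)
    show "P M H \<longleftrightarrow> P M (H \<inter> D M)" for H by (rule Suc.prems(3)) simp
    show "(\<forall>i<M. P i H) \<longleftrightarrow> (\<forall>i<M. P i (H \<inter> (\<Union>i<M. D i)))" for H
    proof -
      have "P i H \<longleftrightarrow> P i (H \<inter> (\<Union>i<M. D i))" if "i < M" for i
      proof -
        have "H \<inter> (\<Union>i<M. D i) \<inter> D i = H \<inter> D i" using that by auto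
        then show ?thesis using Suc.prems(3)[of i] that by (metis less_Suc_eq)
      qed
      then show ?thesis by blast
    qed
  qed (use Suc.prems(1)[of M] in auto)
  moreover have "measure_pmf.prob (random_subset E p) {H. \<forall>i<M. P i H} \<le> q ^ M"
    by (rule Suc.IH) (rule Suc.prems, simp_all)+
  moreover have "measure_pmf.prob (random_subset E p) {H. P M H} \<le> q"
    by (rule Suc.prems(4)) simp
  ultimately show ?case
    by (simp add: mult_mono order_trans[OF measure_nonneg])
qed simp

section \<open>Markov and Chebyshev inequalities for counting variables\<close>

lemma prob_card_ge_le:
  assumes "finite S" "x > 0" and fin: "finite (set_pmf M)"
  shows "measure_pmf.prob M {H. x \<le> real (card {W \<in> S. R W H})}
       \<le> (\<Sum>W\<in>S. measure_pmf.prob M {H. R W H}) / x"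
proof -
  have int: "integrable (measure_pmf M) f" for f :: "'b \<Rightarrow> real"
    by (rule integrable_measure_pmf_finite[OF fin])
  have card: "real (card {W \<in> S. R W H}) = (\<Sum>W\<in>S. indicator {H. R W H} H)" for H
    using assms(1) by (simp add: indicator_def sum.If_cases Int_def)
  have "measure_pmf.prob M {H. x \<le> real (card {W \<in> S. R W H})}
      \<le> measure_pmf.expectation M (\<lambda>H. real (card {W \<in> S. R W H})) / x"
    using integral_Markov_inequality_measure[OF int, of UNIV "\<lambda>H. real (card {W \<in> S. R W H})" x] assms(2)
    by simp
  also have "measure_pmf.expectation M (\<lambda>H. real (card {W \<in> S. R W H})) = (\<Sum>W\<in>S. measure_pmf.prob M {H. R W H})"
    unfolding card by (simp add: int Bochner_Integration.integral_sum)
  finally show ?thesis .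
qed

text \<open>Chebyshev's inequality at distance half the mean. A pair with disjoint edge sets has
  joint probability \<open>p ^ (2 * k)\<close>, the square of the single probability, and cancels in
  the variance; for pairs that share an edge the subtracted square is discarded.\<close>

lemma second_moment_lower_tail:
  fixes F :: "'h \<Rightarrow> 'e set"
  assumes fin: "finite E" "finite \<Omega>" "\<Omega> \<noteq> {}" and p: "0 < p" "p \<le> 1"
    and F: "\<And>h. h \<in> \<Omega> \<Longrightarrow> F h \<subseteq> E" "\<And>h. h \<in> \<Omega> \<Longrightarrow> card (F h) = k"
  shows "measure_pmf.prob (random_subset E p)
           {H. real (card {h \<in> \<Omega>. F h \<subseteq> H}) \<le> real (card \<Omega>) * p ^ k / 2}
       \<le> 4 * (\<Sum>(h, h') | (h, h') \<in> \<Omega> \<times> \<Omega> \<and> F h \<inter> F h' \<noteq> {}. p ^ card (F h \<union> F h'))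
           / (real (card \<Omega>) * p ^ k)\<^sup>2"
proof -
  let ?M = "random_subset E p"
  define \<mu> where "\<mu> = real (card \<Omega>) * p ^ k"
  define X where "X H = real (card {h \<in> \<Omega>. F h \<subseteq> H})" for H
  have int: "integrable (measure_pmf ?M) f" for f :: "'e set \<Rightarrow> real"
    by (rule integrable_measure_pmf_finite[OF finite_set_random_subset[OF fin(1)]])
  have X: "X H = (\<Sum>h\<in>\<Omega>. indicator {H. F h \<subseteq> H} H)" for H
    unfolding X_def using fin by (simp add: indicator_def sum.If_cases Int_def)
  have \<mu>: "measure_pmf.expectation ?M X = \<mu>"
    unfolding X using F p fin
    by (simp add: int Bochner_Integration.integral_sum prob_random_subset_superset \<mu>_def)
  have X2: "(X H)\<^sup>2 = (\<Sum>(h, h')\<in>\<Omega> \<times> \<Omega>. indicator {H. F h \<union> F h' \<subseteq> H} H)" for H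
    unfolding X power2_eq_square sum_product sum.cartesian_product
    by (intro sum.cong) (auto simp: indicator_def)
  have EX2: "measure_pmf.expectation ?M (\<lambda>H. (X H)\<^sup>2) = (\<Sum>(h, h')\<in>\<Omega> \<times> \<Omega>. p ^ card (F h \<union> F h'))"
  proof -
    have "measure_pmf.expectation ?M (\<lambda>H. (X H)\<^sup>2)
        = (\<Sum>z\<in>\<Omega> \<times> \<Omega>. measure_pmf.expectation ?M (indicator {H. F (fst z) \<union> F (snd z) \<subseteq> H}))"
      unfolding X2 case_prod_beta by (rule Bochner_Integration.integral_sum) (rule int)
    also have "\<dots> = (\<Sum>(h, h')\<in>\<Omega> \<times> \<Omega>. p ^ card (F h \<union> F h'))"
    proof (intro sum.cong refl, clarify)
      fix h h' assume "h \<in> \<Omega>" "h' \<in> \<Omega>"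
      then have "F h \<union> F h' \<subseteq> E" using F by auto
      then show "measure_pmf.expectation ?M (indicator {H. F (fst (h, h')) \<union> F (snd (h, h')) \<subseteq> H}) = p ^ card (F h \<union> F h')"
        using prob_random_subset_superset[OF fin(1), of "F h \<union> F h'" p] p by simp
    qed
    finally show ?thesis .
  qed
  let ?N = "{(h, h'). (h, h') \<in> \<Omega> \<times> \<Omega> \<and> F h \<inter> F h' \<noteq> {}}"
  have "measure_pmf.variance ?M X = (\<Sum>(h, h')\<in>\<Omega> \<times> \<Omega>. p ^ card (F h \<union> F h')) - \<mu>\<^sup>2"
    by (subst measure_pmf.variance_eq) (simp_all add: int \<mu> EX2)
  also have "\<mu>\<^sup>2 = (\<Sum>(h, h')\<in>\<Omega> \<times> \<Omega>. p ^ (2 * k))"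
    unfolding \<mu>_def by (simp add: card_cartesian_product power2_eq_square power_mult_distrib
        mult_2 power_add)
  also have "(\<Sum>(h, h')\<in>\<Omega> \<times> \<Omega>. p ^ card (F h \<union> F h')) - (\<Sum>(h, h')\<in>\<Omega> \<times> \<Omega>. p ^ (2 * k))
      = (\<Sum>(h, h')\<in>\<Omega> \<times> \<Omega>. p ^ card (F h \<union> F h') - p ^ (2 * k))"
    by (simp add: sum_subtractf case_prod_beta)
  also have "\<dots> \<le> (\<Sum>(h, h')\<in>\<Omega> \<times> \<Omega>. if F h \<inter> F h' \<noteq> {} then p ^ card (F h \<union> F h') else 0)"
  proof (intro sum_mono, clarify)
    fix h h' assume h: "h \<in> \<Omega>" "h' \<in> \<Omega>"
    have "card (F h \<union> F h') = 2 * k" if "F h \<inter> F h' = {}"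
      using that F[OF h(1)] F[OF h(2)] fin(1)
      by (subst card_Un_disjoint) (auto intro: finite_subset)
    then show "p ^ card (F h \<union> F h') - p ^ (2 * k)
        \<le> (if F h \<inter> F h' \<noteq> {} then p ^ card (F h \<union> F h') else 0)"
      using p by auto
  qed
  also have "\<dots> = (\<Sum>(h, h')\<in>?N. p ^ card (F h \<union> F h'))"
    using fin(2) by (intro sum.mono_neutral_cong_right) (auto split: if_splits)
  finally have var: "measure_pmf.variance ?M X \<le> (\<Sum>(h, h')\<in>?N. p ^ card (F h \<union> F h'))" .
  have "\<mu> > 0" unfolding \<mu>_def using fin p by (simp add: card_gt_0_iff)
  then have "measure_pmf.prob ?M {H \<in> space (measure_pmf ?M). \<mu> / 2 \<le> \<bar>X H - measure_pmf.expectation ?M X\<bar>}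
      \<le> measure_pmf.variance ?M X / (\<mu> / 2)\<^sup>2"
    by (intro measure_pmf.Chebyshev_inequality) (simp_all add: int)
  also have "\<dots> \<le> (\<Sum>(h, h')\<in>?N. p ^ card (F h \<union> F h')) / (\<mu> / 2)\<^sup>2"
    using var by (intro divide_right_mono) auto
  also have "\<dots> = 4 * (\<Sum>(h, h')\<in>?N. p ^ card (F h \<union> F h')) / \<mu>\<^sup>2"
    by (simp add: power_divide)
  finally have "measure_pmf.prob ?M {H \<in> space (measure_pmf ?M). \<mu> / 2 \<le> \<bar>X H - measure_pmf.expectation ?M X\<bar>}
    \<le> 4 * (\<Sum>(h, h')\<in>?N. p ^ card (F h \<union> F h')) / \<mu>\<^sup>2" .
  moreover have "measure_pmf.prob ?M {H. X H \<le> \<mu> / 2}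
      \<le> measure_pmf.prob ?M {H \<in> space (measure_pmf ?M). \<mu> / 2 \<le> \<bar>X H - measure_pmf.expectation ?M X\<bar>}"
    unfolding \<mu> using \<open>\<mu> > 0\<close> by (intro measure_pmf.finite_measure_mono) (auto simp: abs_if)
  ultimately show ?thesis unfolding X_def \<mu>_def by linarith
qed

section \<open>First moments\<close>

lemma powr_neg_power: "x > 0 \<Longrightarrow> (x powr (- \<alpha>)) ^ k = x powr (- \<alpha> * real k)"
  for x :: real
  by (simp add: powr_powr flip: powr_realpow)

lemma powr_neg_le_one: "n \<ge> 1 \<Longrightarrow> \<alpha> > 0 \<Longrightarrow> real n powr (- \<alpha>) \<le> 1"
  by (simp add: powr_minus ge_one_powr_ge_zero inverse_le_1_iff)

text \<open>There are at most \<open>n ^ k\<close> supersets with exactly \<open>k\<close> new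
  vertices, each of weight \<open>n\<close> to the power \<open>-k\<close>, so every
  \<open>k\<close> from \<open>0\<close> to \<open>L\<close> contributes at most
  \<open>1\<close>.\<close>

lemma sum_supersets_powr_le:
  assumes "n \<ge> 1"
  shows "(\<Sum>W | A \<subseteq> W \<and> W \<subseteq> {1..n} \<and> card (W - A) \<le> L. real n powr (- real (card (W - A)))) \<le> real L + 1"
proof -
  let ?S = "{W. A \<subseteq> W \<and> W \<subseteq> {1..n} \<and> card (W - A) \<le> L}"
  let ?T = "\<lambda>k. {W. A \<subseteq> W \<and> W \<subseteq> {1..n} \<and> card (W - A) = k}"
  have fin: "finite (?T k)" for k by (rule finite_subset[of _ "Pow {1..n}"]) auto
  have "?S = (\<Union>k\<in>{..L}. ?T k)" by auto
  then have "(\<Sum>W\<in>?S. real n powr (- real (card (W - A))))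
      = (\<Sum>k\<le>L. \<Sum>W\<in>?T k. real n powr (- real (card (W - A))))"
    using fin by (simp only:) (rule sum.UNION_disjoint, auto)
  also have "\<dots> = (\<Sum>k\<le>L. real (card (?T k)) * real n powr (- real k))"
    by (intro sum.cong) auto
  also have "\<dots> \<le> (\<Sum>k\<le>L. 1)"
  proof (intro sum_mono)
    fix k assume "k \<in> {..L}"
    have "card (?T k) \<le> card {U. U \<subseteq> {1..n} \<and> card U = k}"
    proof (rule card_inj_on_le)
      show "inj_on (\<lambda>W. W - A) (?T k)" by (auto intro!: inj_onI)
      show "finite {U. U \<subseteq> {1..n} \<and> card U = k}" by (rule finite_subset[of _ "Pow {1..n}"]) auto
    qed auto
    also have "\<dots> \<le> n ^ k" by (cases "k \<le> n") (simp_all add: n_subsets binomial_le_pow binomial_eq_0)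
    finally have "real (card (?T k)) \<le> real n ^ k"
      by (simp only: flip: of_nat_power)
    then have "real (card (?T k)) * real n powr (- real k) \<le> real n ^ k * real n powr (- real k)"
      by (rule mult_right_mono) simp
    also have "\<dots> = 1"
      using assms by (simp add: powr_minus powr_realpow)
    finally show "real (card (?T k)) * real n powr (- real k) \<le> 1" .
  qed
  finally show ?thesis by simp
qed

text \<open>The event forces many new edges inside \<open>W\<close>. A union bound over all
  candidate families \<open>G\<close> of subsets of \<open>W\<close> gives the double exponential
  factor, and each \<open>G\<close> is present with probability at most
  \<open>n powr (- \<alpha> * card G)\<close>.\<close>

lemma prob_predim_diff_le:
  assumes fin: "finite E" and n: "n \<ge> 1" and \<alpha>: "\<alpha> > 0" and W: "A \<subseteq> W" "finite W"
  shows "measure_pmf.prob (random_subset E (real n powr (- \<alpha>))) {H. predim \<alpha> H W - predim \<alpha> H A \<le> c}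
       \<le> 2 ^ (2 ^ card W) * real n powr (c - real (card (W - A)))"
proof -
  let ?M = "random_subset E (real n powr (- \<alpha>))"
  define \<G> where "\<G> = {G. G \<subseteq> Pow W \<and> real (card (W - A)) - \<alpha> * real (card G) \<le> c}"
  have fin\<G>: "finite \<G>" unfolding \<G>_def by (rule finite_subset[of _ "Pow (Pow W)"]) (use W in auto)
  have "{H. predim \<alpha> H W - predim \<alpha> H A \<le> c} \<subseteq> (\<Union>G\<in>\<G>. {H. G \<subseteq> H})"
  proof clarify
    fix H assume "predim \<alpha> H W - predim \<alpha> H A \<le> c"
    then have "new_edges H A W \<in> \<G>"
      unfolding predim_diff[OF W] \<G>_def by (auto simp: new_edges_def)
    moreover have "new_edges H A W \<subseteq> H" unfolding new_edges_def by auto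
    ultimately show "H \<in> (\<Union>G\<in>\<G>. {H. G \<subseteq> H})" by auto
  qed
  then have "measure_pmf.prob ?M {H. predim \<alpha> H W - predim \<alpha> H A \<le> c} \<le> measure_pmf.prob ?M (\<Union>G\<in>\<G>. {H. G \<subseteq> H})"
    by (intro measure_pmf.finite_measure_mono) auto
  also have "\<dots> \<le> (\<Sum>G\<in>\<G>. measure_pmf.prob ?M {H. G \<subseteq> H})"
    using fin\<G> by (intro measure_pmf.finite_measure_subadditive_finite) auto
  also have "\<dots> \<le> (\<Sum>G\<in>\<G>. real n powr (c - real (card (W - A))))"
  proof (intro sum_mono)
    fix G assume "G \<in> \<G>"
    then have c: "- \<alpha> * real (card G) \<le> c - real (card (W - A))" unfolding \<G>_def by auto
    have "measure_pmf.prob ?M {H. G \<subseteq> H} \<le> (real n powr (- \<alpha>)) ^ card G"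
      using n \<alpha> by (intro prob_random_subset_superset_le fin powr_neg_le_one) auto
    also have "\<dots> = real n powr (- \<alpha> * real (card G))" using n by (intro powr_neg_power) simp
    also have "\<dots> \<le> real n powr (c - real (card (W - A)))"
      using n c by (intro powr_mono) auto
    finally show "measure_pmf.prob ?M {H. G \<subseteq> H} \<le> real n powr (c - real (card (W - A)))" .
  qed
  also have "\<dots> = real (card \<G>) * real n powr (c - real (card (W - A)))" by simp
  also have "\<dots> \<le> 2 ^ (2 ^ card W) * real n powr (c - real (card (W - A)))"
  proof (intro mult_right_mono)
    have "card \<G> \<le> card (Pow (Pow W))" unfolding \<G>_def using W(2) by (intro card_mono) auto
    also have "\<dots> = 2 ^ (2 ^ card W)" using W(2) by (simp add: card_Pow)
    finally show "real (card \<G>) \<le> 2 ^ (2 ^ card W)"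
      by simp
  qed simp
  finally show ?thesis .
qed

text \<open>The inner comprehension is independent of the edges and the outer condition is random,
  which is the shape of the count in \<open>prob_card_ge_le\<close>.\<close>

definition low_extensions :: "real \<Rightarrow> nat \<Rightarrow> real \<Rightarrow> 'a hypergraph \<Rightarrow> 'a set \<Rightarrow> 'a set set" where
  "low_extensions \<alpha> L c H A =
     {W \<in> {W. A \<subseteq> W \<and> W \<subseteq> fst H \<and> card (W - A) \<le> L}. predim \<alpha> (snd H) W - predim \<alpha> (snd H) A \<le> c}"

text \<open>The expected number is at most of order \<open>n powr c\<close>: the probability bound
  for a set with \<open>k\<close> new vertices carries a factor \<open>n\<close> to the power
  \<open>-k\<close>, which offsets the number of choices. Markov's inequality does the rest.\<close>

lemma prob_low_extensions_ge_le:
  assumes fin: "finite E" and n: "n \<ge> 1" and \<alpha>: "\<alpha> > 0" and a: "A \<subseteq> {1..n}" "card A \<le> a" and x: "x > 0"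
  shows "measure_pmf.prob (random_subset E (real n powr (- \<alpha>)))
           {H. x \<le> real (card (low_extensions \<alpha> L c ({1..n}, H) A))}
       \<le> (real L + 1) * 2 ^ (2 ^ (a + L)) * real n powr c / x"
proof -
  let ?M = "random_subset E (real n powr (- \<alpha>))"
  let ?S = "{W. A \<subseteq> W \<and> W \<subseteq> {1..n} \<and> card (W - A) \<le> L}"
  have finS: "finite ?S" by (rule finite_subset[of _ "Pow {1..n}"]) auto
  have "(\<Sum>W\<in>?S. measure_pmf.prob ?M {H. predim \<alpha> H W - predim \<alpha> H A \<le> c})
      \<le> (\<Sum>W\<in>?S. 2 ^ (2 ^ (a + L)) * real n powr c * real n powr (- real (card (W - A))))"
  proof (intro sum_mono)
    fix W assume W: "W \<in> ?S"
    then have finW: "finite W" using finite_subset by blast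
    have "card W = card A + card (W - A)"
      using W finW card_Diff_subset[of A W] card_mono[of W A] finite_subset[of A W] by auto
    then have card: "card W \<le> a + L" using W a by auto
    have "measure_pmf.prob ?M {H. predim \<alpha> H W - predim \<alpha> H A \<le> c}
        \<le> 2 ^ (2 ^ card W) * real n powr (c - real (card (W - A)))"
      using W finW by (intro prob_predim_diff_le fin n \<alpha>) auto
    also have "\<dots> \<le> 2 ^ (2 ^ (a + L)) * real n powr (c - real (card (W - A)))"
      using card by (intro mult_right_mono power_increasing) auto
    also have "\<dots> = 2 ^ (2 ^ (a + L)) * real n powr c * real n powr (- real (card (W - A)))"
      using powr_add[of "real n" c "- real (card (W - A))"] by simp
    finally show "measure_pmf.prob ?M {H. predim \<alpha> H W - predim \<alpha> H A \<le> c}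
        \<le> 2 ^ (2 ^ (a + L)) * real n powr c * real n powr (- real (card (W - A)))" .
  qed
  also have "\<dots> \<le> 2 ^ (2 ^ (a + L)) * real n powr c * (real L + 1)"
    unfolding sum_distrib_left[symmetric] using sum_supersets_powr_le[OF n] by (intro mult_left_mono) auto
  finally have "(\<Sum>W\<in>?S. measure_pmf.prob ?M {H. predim \<alpha> H W - predim \<alpha> H A \<le> c}) / x
      \<le> (real L + 1) * 2 ^ (2 ^ (a + L)) * real n powr c / x"
    using x by (intro divide_right_mono) (auto simp: mult_ac)
  then show ?thesis
    unfolding low_extensions_def fst_conv snd_conv
    using prob_card_ge_le[OF finS x finite_set_random_subset[OF fin], of _ "\<lambda>W H. predim \<alpha> H W - predim \<alpha> H A \<le> c"]
    by (rule order_trans[rotated])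
qed

section \<open>Moments of the number of bad copies\<close>

lemma finite_low_extensions: "finite (fst H) \<Longrightarrow> finite (low_extensions \<alpha> L c H A)"
  unfolding low_extensions_def by (rule finite_subset[of _ "Pow (fst H)"]) auto

text \<open>Along a list of functions the union of their images (and witnesses) gains at most
  \<open>d - \<epsilon>\<close> per step, because by submodularity the gain is bounded by the gain over a set
  that contains \<open>A\<close> and hence, \<open>A\<close> being closed, has at least the predimension of \<open>A\<close>.\<close>

lemma low_extension_of_list:
  assumes \<alpha>: "\<alpha> > 0" and finV: "finite (fst H)" and A: "A \<subseteq> fst H"
    and cl: "closed_upto \<alpha> T H A" and T: "card B - card A + t \<le> T" and finB: "finite B"
    and gap: "\<And>v e :: nat. v \<le> card B + t \<Longrightarrow> real v - \<alpha> * real e < d \<Longrightarrow> real v - \<alpha> * real e \<le> d - \<epsilon>"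
    and hs: "\<And>h. h \<in> set hs \<Longrightarrow> h \<in> B \<rightarrow>\<^sub>E fst H \<and> A \<subseteq> h ` B \<and>
       (\<exists>Z \<subseteq> fst H. card Z \<le> t \<and> predim \<alpha> (snd H) (h ` B \<union> Z) - predim \<alpha> (snd H) A < d)"
  shows "\<exists>W \<in> low_extensions \<alpha> (length hs * (card B + t)) (real (length hs) * (d - \<epsilon>)) H A. \<forall>h\<in>set hs. h ` B \<subseteq> W"
  using hs
proof (induction hs)
  case Nil
  show ?case using A by (auto simp: low_extensions_def)
next
  case (Cons h hs)
  let ?f = "predim \<alpha> (snd H)"
  obtain W where W: "A \<subseteq> W" "W \<subseteq> fst H" "card (W - A) \<le> length hs * (card B + t)"
      "?f W - ?f A \<le> real (length hs) * (d - \<epsilon>)" "\<forall>h\<in>set hs. h ` B \<subseteq> W"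
    using Cons.IH Cons.prems unfolding low_extensions_def by auto
  obtain Z where Z: "Z \<subseteq> fst H" "card Z \<le> t" "?f (h ` B \<union> Z) - ?f A < d"
    and h: "h \<in> B \<rightarrow>\<^sub>E fst H" "A \<subseteq> h ` B"
    using Cons.prems[of h] by auto
  define D where "D = h ` B \<union> Z"
  have D: "D \<subseteq> fst H" "A \<subseteq> D" using h Z(1) unfolding D_def by auto
  have fin: "finite W" "finite D" "finite A" "finite Z"
    using W(2) D(1) A Z(1) finV finite_subset by blast+
  have cB: "card (h ` B) \<le> card B" using finB card_image_le by blast
  have cD: "card D \<le> card B + t"
    unfolding D_def using card_Un_le[of "h ` B" Z] Z(2) cB by linarith
  have "card (D - A) \<le> card ((h ` B - A) \<union> Z)"
    unfolding D_def using finB fin by (intro card_mono) auto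
  also have "\<dots> \<le> card (h ` B - A) + card Z" by (rule card_Un_le)
  also have "\<dots> \<le> card B - card A + t"
    using card_Diff_subset[OF fin(3) h(2)] cB Z(2) by linarith
  also have "\<dots> \<le> T" by (rule T)
  finally have cDA: "card (D - A) \<le> T" .
  have "card (W \<inter> D - A) \<le> card (D - A)" using fin by (intro card_mono) auto
  then have "card (W \<inter> D - A) \<le> T" using cDA by simp
  then have "?f A \<le> ?f (A \<union> (W \<inter> D - A))"
    using cl W(2) fin unfolding closed_upto_def by (metis Diff_subset finite_Diff finite_Int inf.coboundedI1 subset_trans)
  moreover have "A \<union> (W \<inter> D - A) = W \<inter> D" using W(1) D(2) by auto
  ultimately have AI: "?f A \<le> ?f (W \<inter> D)" by simp
  have "?f D - ?f (W \<inter> D) < d" using Z(3) AI unfolding D_def by linarith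
  then have "?f D - ?f (W \<inter> D) \<le> d - \<epsilon>"
    unfolding predim_diff[OF Int_lower2 fin(2)]
    using cD card_mono[OF fin(2), of "D - W \<inter> D"] by (intro gap) auto
  moreover have "?f (W \<union> D) + ?f (W \<inter> D) \<le> ?f W + ?f D"
    using fin \<alpha> by (intro predim_submodular) auto
  ultimately have "?f (W \<union> D) - ?f A \<le> real (length (h # hs)) * (d - \<epsilon>)"
    using W(4) by (simp add: algebra_simps)
  moreover have "card (W \<union> D - A) \<le> length (h # hs) * (card B + t)"
  proof -
    have "card (W \<union> D - A) \<le> card ((W - A) \<union> D)" using fin by (intro card_mono) auto
    also have "\<dots> \<le> card (W - A) + card D" by (rule card_Un_le)
    finally show ?thesis using W(3) cD by simp
  qed
  ultimately have "W \<union> D \<in> low_extensions \<alpha> (length (h # hs) * (card B + t)) (real (length (h # hs)) * (d - \<epsilon>)) H A"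
    using W(1,2) D(1) unfolding low_extensions_def by auto
  moreover have "\<forall>h\<in>set (h # hs). h ` B \<subseteq> W \<union> D" using W(5) unfolding D_def by auto
  ultimately show ?case by blast
qed

text \<open>When \<open>d\<close> is the exponent of the pattern, one condition covers both defects
  of a copy: \<open>Z = {}\<close> detects unexpected edges, and the other \<open>Z\<close> detect a
  failure of closedness.\<close>

definition bad_maps :: "real \<Rightarrow> nat \<Rightarrow> real \<Rightarrow> 'a hypergraph \<Rightarrow> 'a set \<Rightarrow> 'b set \<Rightarrow> ('b \<Rightarrow> 'a) set" where
  "bad_maps \<alpha> t d H A B = {h \<in> B \<rightarrow>\<^sub>E fst H. A \<subseteq> h ` B \<and>
     (\<exists>Z \<subseteq> fst H. card Z \<le> t \<and> predim \<alpha> (snd H) (h ` B \<union> Z) - predim \<alpha> (snd H) A < d)}"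

text \<open>The left side counts \<open>K\<close>-tuples of bad maps. All maps of a tuple have their
  images in one low extension \<open>W\<close>, and as \<open>W\<close> has bounded size, only
  boundedly many tuples belong to each \<open>W\<close>.\<close>

lemma card_bad_maps_power_le:
  assumes \<alpha>: "\<alpha> > 0" and finV: "finite (fst H)" and A: "A \<subseteq> fst H" "card A \<le> a"
    and cl: "closed_upto \<alpha> T H A" and T: "card B - card A + t \<le> T" and finB: "finite B"
    and gap: "\<And>v e :: nat. v \<le> card B + t \<Longrightarrow> real v - \<alpha> * real e < d \<Longrightarrow> real v - \<alpha> * real e \<le> d - \<epsilon>"
  shows "card (bad_maps \<alpha> t d H A B) ^ K
     \<le> card (low_extensions \<alpha> (K * (card B + t)) (real K * (d - \<epsilon>)) H A)
         * (1 + a + K * (card B + t)) ^ (card B * K)"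
proof -
  let ?Bad = "bad_maps \<alpha> t d H A B"
  let ?W = "low_extensions \<alpha> (K * (card B + t)) (real K * (d - \<epsilon>)) H A"
  have fBad: "finite ?Bad"
    unfolding bad_maps_def by (rule finite_subset[of _ "B \<rightarrow>\<^sub>E fst H"]) (auto intro: finite_PiE finB finV)
  have sub: "{hs. set hs \<subseteq> ?Bad \<and> length hs = K} \<subseteq> (\<Union>W\<in>?W. {hs. set hs \<subseteq> B \<rightarrow>\<^sub>E W \<and> length hs = K})"
  proof
    fix hs assume "hs \<in> {hs. set hs \<subseteq> ?Bad \<and> length hs = K}"
    then have hs: "set hs \<subseteq> ?Bad" "length hs = K" by auto
    obtain W where W: "W \<in> ?W" "\<forall>h\<in>set hs. h ` B \<subseteq> W"
      using low_extension_of_list[OF \<alpha> finV A(1) cl T finB gap, of hs] hs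
      unfolding bad_maps_def by blast
    have "set hs \<subseteq> B \<rightarrow>\<^sub>E W"
    proof
      fix h assume h: "h \<in> set hs"
      then have "h \<in> B \<rightarrow>\<^sub>E fst H" using hs(1) unfolding bad_maps_def by blast
      then show "h \<in> B \<rightarrow>\<^sub>E W" using W(2) h by (auto simp: PiE_iff)
    qed
    then show "hs \<in> (\<Union>W\<in>?W. {hs. set hs \<subseteq> B \<rightarrow>\<^sub>E W \<and> length hs = K})" using W(1) hs(2) by blast
  qed
  have finW: "finite W" if "W \<in> ?W" for W
    using that finV finite_subset unfolding low_extensions_def by blast
  have finU: "finite {hs. set hs \<subseteq> B \<rightarrow>\<^sub>E W \<and> length hs = K}" if "W \<in> ?W" for W
    by (intro finite_lists_length_eq finite_PiE finB finW that)
  have "card ?Bad ^ K = card {hs. set hs \<subseteq> ?Bad \<and> length hs = K}"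
    using fBad by (simp add: card_lists_length_eq)
  also have "\<dots> \<le> card (\<Union>W\<in>?W. {hs. set hs \<subseteq> B \<rightarrow>\<^sub>E W \<and> length hs = K})"
    using sub finU finite_low_extensions[OF finV] by (intro card_mono finite_UN_I) auto
  also have "\<dots> \<le> (\<Sum>W\<in>?W. card {hs. set hs \<subseteq> B \<rightarrow>\<^sub>E W \<and> length hs = K})"
    by (rule card_UN_le[OF finite_low_extensions[OF finV]])
  also have "\<dots> \<le> (\<Sum>W\<in>?W. (1 + a + K * (card B + t)) ^ (card B * K))"
  proof (rule sum_mono)
    fix W assume W: "W \<in> ?W"
    have "card W \<le> card A + card (W - A)"
      using W finW[OF W] card_Un_le[of A "W - A"] unfolding low_extensions_def by (simp add: Un_absorb1)
    then have "card W \<le> 1 + a + K * (card B + t)"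
      using W A(2) unfolding low_extensions_def by auto
    then have "card W ^ (card B * K) \<le> (1 + a + K * (card B + t)) ^ (card B * K)"
      by (rule power_mono) simp
    moreover have "card {hs. set hs \<subseteq> B \<rightarrow>\<^sub>E W \<and> length hs = K} = card W ^ (card B * K)"
      using finB finW[OF W] by (simp add: card_lists_length_eq card_PiE finite_PiE power_mult)
    ultimately show "card {hs. set hs \<subseteq> B \<rightarrow>\<^sub>E W \<and> length hs = K} \<le> (1 + a + K * (card B + t)) ^ (card B * K)"
      by simp
  qed
  finally show ?thesis by simp
qed

text \<open>At least \<open>x\<close> bad maps force a constant fraction of \<open>x ^ K\<close> low
  extensions, whose expected number is at most of order
  \<open>n powr (K * (d - \<epsilon>))\<close>. Closedness of \<open>A\<close> is part of the event
  because the tuple count relies on it.\<close>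

lemma prob_many_bad_maps_le:
  fixes K :: nat
  assumes fin: "finite E" and n: "n \<ge> 1" and \<alpha>: "\<alpha> > 0" and A: "A \<subseteq> {1..n}" "card A \<le> a"
    and T: "card B - card A + t \<le> T" and finB: "finite B" and x: "x > 0"
    and gap: "\<And>v e :: nat. v \<le> card B + t \<Longrightarrow> real v - \<alpha> * real e < d \<Longrightarrow> real v - \<alpha> * real e \<le> d - \<epsilon>"
  defines "L \<equiv> K * (card B + t)"
  shows "measure_pmf.prob (random_subset E (real n powr (- \<alpha>)))
      {H. closed_upto \<alpha> T ({1..n}, H) A \<and> x \<le> real (card (bad_maps \<alpha> t d ({1..n}, H) A B))}
    \<le> (real L + 1) * 2 ^ (2 ^ (a + L)) * (1 + real a + real L) ^ (card B * K)
        * real n powr (real K * (d - \<epsilon>)) / x ^ K"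
proof -
  let ?M = "random_subset E (real n powr (- \<alpha>))"
  define C where "C = (1 + real a + real L) ^ (card B * K)"
  have "C > 0" unfolding C_def by simp
  have "x ^ K / C \<le> real (card (low_extensions \<alpha> L (real K * (d - \<epsilon>)) ({1..n}, H) A))"
    if H: "closed_upto \<alpha> T ({1..n}, H) A" "x \<le> real (card (bad_maps \<alpha> t d ({1..n}, H) A B))" for H
  proof -
    have "x ^ K \<le> real (card (bad_maps \<alpha> t d ({1..n}, H) A B)) ^ K"
      using H(2) x by (intro power_mono) auto
    also have "\<dots> = real (card (bad_maps \<alpha> t d ({1..n}, H) A B) ^ K)" by simp
    also have "\<dots> \<le> real (card (low_extensions \<alpha> L (real K * (d - \<epsilon>)) ({1..n}, H) A)
         * (1 + a + L) ^ (card B * K))"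
      unfolding L_def of_nat_le_iff
      by (rule card_bad_maps_power_le[OF \<alpha> _ _ A(2) H(1) T finB gap]) (use A in auto)
    also have "\<dots> = real (card (low_extensions \<alpha> L (real K * (d - \<epsilon>)) ({1..n}, H) A)) * C"
      unfolding C_def by (simp add: add.assoc)
    finally show ?thesis using \<open>C > 0\<close> by (simp add: field_simps)
  qed
  then have "measure_pmf.prob ?M {H. closed_upto \<alpha> T ({1..n}, H) A \<and> x \<le> real (card (bad_maps \<alpha> t d ({1..n}, H) A B))}
      \<le> measure_pmf.prob ?M {H. x ^ K / C \<le> real (card (low_extensions \<alpha> L (real K * (d - \<epsilon>)) ({1..n}, H) A))}"
    by (intro measure_pmf.finite_measure_mono) auto
  also have "\<dots> \<le> (real L + 1) * 2 ^ (2 ^ (a + L)) * real n powr (real K * (d - \<epsilon>)) / (x ^ K / C)"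
    using \<open>C > 0\<close> x by (intro prob_low_extensions_ge_le fin n \<alpha> A) auto
  also have "\<dots> = (real L + 1) * 2 ^ (2 ^ (a + L)) * C * real n powr (real K * (d - \<epsilon>)) / x ^ K"
    by simp
  finally show ?thesis unfolding C_def .
qed

section \<open>Lower tails\<close>

text \<open>As the classes are disjoint, a vertex lying in both images comes from the same pattern
  vertex. A shared image edge therefore comes from one pattern edge, on which the two maps agree
  pointwise.\<close>

lemma box_pair_edges:
  assumes disj: "disjoint_family_on Cl B" and E1: "\<And>e. e \<in> E1 \<Longrightarrow> e \<subseteq> B"
    and h: "h \<in> PiE B Cl" "h' \<in> PiE B Cl"
  shows "(`) h ` E1 \<inter> (`) h' ` E1 \<subseteq> (`) h ` {e \<in> E1. \<forall>b\<in>e. h b = h' b}"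
proof -
  have eq: "b = b'" if "b \<in> B" "b' \<in> B" "h b = h' b'" for b b'
  proof (rule ccontr)
    assume "b \<noteq> b'"
    then have "Cl b \<inter> Cl b' = {}" using disj that by (auto simp: disjoint_family_on_def)
    moreover have "h b \<in> Cl b" "h' b' \<in> Cl b'" using PiE_mem[OF h(1) that(1)] PiE_mem[OF h(2) that(2)] .
    ultimately show False using that by auto
  qed
  show ?thesis
  proof
    fix x assume "x \<in> (`) h ` E1 \<inter> (`) h' ` E1"
    then obtain e e' where e: "e \<in> E1" "e' \<in> E1" "x = h ` e" "h ` e = h' ` e'" by auto
    have "h b = h' b" if "b \<in> e" for b
    proof -
      have "h b \<in> h' ` e'" using that e(4) by blast
      then obtain b' where "b' \<in> e'" "h b = h' b'" by blast
      moreover then have "b = b'" using eq that E1 e by blast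
      ultimately show ?thesis by simp
    qed
    then have "e \<in> {e \<in> E1. \<forall>b\<in>e. h b = h' b}" using e(1) by simp
    then show "x \<in> (`) h ` {e \<in> E1. \<forall>b\<in>e. h b = h' b}" unfolding e(3) by (rule imageI)
  qed
qed

lemma inj_on_box:
  assumes "disjoint_family_on Cl B" "h \<in> PiE B Cl"
  shows "inj_on h B"
proof (rule inj_onI, rule ccontr)
  fix b b' assume b: "b \<in> B" "b' \<in> B" "h b = h b'" "b \<noteq> b'"
  then have "Cl b \<inter> Cl b' = {}" using assms(1) by (auto simp: disjoint_family_on_def)
  then show False using PiE_mem[OF assms(2) b(1)] PiE_mem[OF assms(2) b(2)] b(3) by auto
qed

lemma card_image_edges:
  assumes "inj_on h B" "\<And>e. e \<in> E1 \<Longrightarrow> e \<subseteq> B"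
  shows "card ((`) h ` E1) = card E1"
  by (intro card_image inj_onI) (use assms inj_on_image_eq_iff in metis)

text \<open>The maps of a box choose one vertex in each class, so they are injective and all agree
  on \<open>A\<close>. Pairs are grouped by the set \<open>S\<close> of new pattern vertices on
  which they agree: agreement costs a factor \<open>n ^ card S\<close> of choices and shares at most
  the edges inside \<open>A \<union> S\<close>, so relative to the squared mean each group has order
  at most \<open>n powr (- \<gamma>)\<close>.\<close>

lemma box_lower_tail:
  fixes Cl :: "'b \<Rightarrow> 'a set" and E :: "'a set set"
  assumes fin: "finite E" and n: "n \<ge> 1" and \<alpha>: "\<alpha> > 0"
    and B: "finite B" "A \<subseteq> B" and E1: "\<And>e. e \<in> E1 \<Longrightarrow> e \<subseteq> B" "\<And>e. e \<in> E1 \<Longrightarrow> \<not> e \<subseteq> A"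
    and disj: "disjoint_family_on Cl B" and ClA: "\<And>a. a \<in> A \<Longrightarrow> card (Cl a) = 1"
    and ClB: "\<And>b. b \<in> B - A \<Longrightarrow> finite (Cl b)" "\<And>b. b \<in> B - A \<Longrightarrow> c * real n \<le> real (card (Cl b))"
      "\<And>b. b \<in> B - A \<Longrightarrow> card (Cl b) \<le> n"
    and c: "c > 0" and FE: "\<And>h e. h \<in> PiE B Cl \<Longrightarrow> e \<in> E1 \<Longrightarrow> h ` e \<in> E"
    and \<gamma>: "\<And>S. S \<subseteq> B - A \<Longrightarrow> S \<noteq> {} \<Longrightarrow> \<gamma> \<le> real (card S) - \<alpha> * real (card {e \<in> E1. e \<subseteq> A \<union> S})"
  shows "measure_pmf.prob (random_subset E (real n powr (- \<alpha>)))
      {H. real (card {h \<in> PiE B Cl. (`) h ` E1 \<subseteq> H})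
          \<le> c ^ card (B - A) / 2 * real n powr (real (card (B - A)) - \<alpha> * real (card E1))}
    \<le> 4 * 2 ^ card (B - A) / c ^ card (B - A) * real n powr (- \<gamma>)"
proof -
  define p where "p = real n powr (- \<alpha>)"
  define v where "v = card (B - A)"
  define k where "k = card E1"
  define \<Omega> where "\<Omega> = PiE B Cl"
  have p: "0 < p" "p \<le> 1" unfolding p_def using n \<alpha> powr_neg_le_one[of n \<alpha>] by auto
  have finE1: "finite E1"
    by (rule finite_subset[of _ "Pow B"]) (use B E1 in auto)
  have finCl: "finite (Cl b)" if "b \<in> B" for b
    using that ClA[of b] ClB(1)[of b] by (cases "b \<in> A") (auto simp: card_eq_0_iff intro: card_ge_0_finite)
  have fin\<Omega>: "finite \<Omega>" unfolding \<Omega>_def by (rule finite_PiE[OF B(1) finCl])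
  have card\<Omega>: "card \<Omega> = (\<Prod>b\<in>B - A. card (Cl b))"
  proof -
    have "card \<Omega> = (\<Prod>b\<in>B. card (Cl b))" unfolding \<Omega>_def by (rule card_PiE[OF B(1)])
    also have "\<dots> = (\<Prod>b\<in>B - A. card (Cl b))"
      using B ClA by (intro prod.mono_neutral_right) auto
    finally show ?thesis .
  qed
  have \<Omega>_ge: "(c * real n) ^ v \<le> real (card \<Omega>)"
  proof -
    have "(c * real n) ^ v = (\<Prod>b\<in>B - A. c * real n)" unfolding v_def by simp
    also have "\<dots> \<le> (\<Prod>b\<in>B - A. real (card (Cl b)))"
      using ClB(2) c by (intro prod_mono) auto
    finally show ?thesis unfolding card\<Omega> by simp
  qed
  have cn: "0 < (c * real n) ^ v" using c n by simp
  then have \<Omega>pos: "0 < real (card \<Omega>)" using \<Omega>_ge by linarith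
  then have \<Omega>ne: "\<Omega> \<noteq> {}" by auto
  define agree where "agree h h' = {b \<in> B - A. h b = h' b}" for h h' :: "'b \<Rightarrow> 'a"
  define eS where "eS S = card {e \<in> E1. e \<subseteq> A \<union> S}" for S
  have card_union: "p ^ card ((`) h ` E1 \<union> (`) h' ` E1) \<le> p ^ (2 * k) * real n powr (\<alpha> * real (eS (agree h h')))"
    and nonempty: "(`) h ` E1 \<inter> (`) h' ` E1 \<noteq> {} \<Longrightarrow> agree h h' \<noteq> {}"
    if h: "h \<in> \<Omega>" "h' \<in> \<Omega>" for h h'
  proof -
    have sub: "(`) h ` E1 \<inter> (`) h' ` E1 \<subseteq> (`) h ` {e \<in> E1. e \<subseteq> A \<union> agree h h'}"
    proof -
      have "{e \<in> E1. \<forall>b\<in>e. h b = h' b} \<subseteq> {e \<in> E1. e \<subseteq> A \<union> agree h h'}"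
        using E1(1) unfolding agree_def by blast
      then show ?thesis
        using box_pair_edges[OF disj E1(1) h[unfolded \<Omega>_def]] by (meson image_mono subset_trans)
    qed
    then have "card ((`) h ` E1 \<inter> (`) h' ` E1) \<le> card ((`) h ` {e \<in> E1. e \<subseteq> A \<union> agree h h'})"
      using finE1 by (intro card_mono) auto
    also have "\<dots> \<le> eS (agree h h')" unfolding eS_def using finE1 by (intro card_image_le) auto
    finally have "card ((`) h ` E1 \<inter> (`) h' ` E1) \<le> eS (agree h h')" .
    moreover have "card ((`) h ` E1) = k" "card ((`) h' ` E1) = k"
      unfolding k_def using h unfolding \<Omega>_def
      by (simp_all add: card_image_edges[OF inj_on_box[OF disj] E1(1)])
    moreover have "card ((`) h ` E1) + card ((`) h' ` E1)
        = card ((`) h ` E1 \<union> (`) h' ` E1) + card ((`) h ` E1 \<inter> (`) h' ` E1)"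
      using finE1 by (intro card_Un_Int) auto
    ultimately have le: "2 * k \<le> card ((`) h ` E1 \<union> (`) h' ` E1) + eS (agree h h')" by linarith
    have "p ^ card ((`) h ` E1 \<union> (`) h' ` E1) * p ^ eS (agree h h') \<le> p ^ (2 * k)"
      unfolding power_add[symmetric] using le p by (intro power_decreasing) auto
    moreover have "p ^ eS (agree h h') = inverse (real n powr (\<alpha> * real (eS (agree h h'))))"
      unfolding p_def using n powr_neg_power[of "real n" \<alpha> "eS (agree h h')"] by (simp add: powr_minus)
    ultimately show "p ^ card ((`) h ` E1 \<union> (`) h' ` E1) \<le> p ^ (2 * k) * real n powr (\<alpha> * real (eS (agree h h')))"
      using n by (simp add: field_simps)
    \<comment> \<open>A shared edge is the image of a pattern edge inside
      \<open>A \<union> agree h h'\<close>, and no pattern edge lies inside \<open>A\<close>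
      alone.\<close>
    show "agree h h' \<noteq> {}" if "(`) h ` E1 \<inter> (`) h' ` E1 \<noteq> {}"
    proof -
      have "{e \<in> E1. e \<subseteq> A \<union> agree h h'} \<noteq> {}" using sub that by (metis image_empty subset_empty)
      then obtain e where "e \<in> E1" "e \<subseteq> A \<union> agree h h'" by auto
      then show ?thesis using E1(2)[of e] by auto
    qed
  qed
  have count: "real (card {z \<in> \<Omega> \<times> \<Omega>. agree (fst z) (snd z) = S}) \<le> real (card \<Omega>) * real n ^ (v - card S)"
    if S: "S \<subseteq> B - A" for S
  proof -
    \<comment> \<open>For fixed \<open>h\<close>, the values of \<open>h'\<close> on
      \<open>S\<close> are prescribed, those on \<open>A\<close> have one choice, and the other
      \<open>v - card S\<close> coordinates have at most \<open>n\<close> choices each.\<close>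
    have each: "card {h' \<in> \<Omega>. agree h h' = S} \<le> n ^ (v - card S)" if h: "h \<in> \<Omega>" for h
    proof -
      let ?P = "PiE B (\<lambda>b. if b \<in> S then {h b} else Cl b)"
      have "{h' \<in> \<Omega>. agree h h' = S} \<subseteq> ?P"
      proof
        fix h' assume "h' \<in> {h' \<in> \<Omega>. agree h h' = S}"
        then have h': "h' \<in> PiE B Cl" "\<And>b. b \<in> S \<Longrightarrow> h' b = h b" unfolding \<Omega>_def agree_def by auto
        show "h' \<in> ?P"
          by (rule PiE_I) (use h' PiE_arb[OF h'(1)] in \<open>auto simp: PiE_iff\<close>)
      qed
      moreover have "finite ?P" using finCl B(1) by (intro finite_PiE) auto
      ultimately have "card {h' \<in> \<Omega>. agree h h' = S} \<le> card ?P" by (rule card_mono[rotated])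
      also have "\<dots> = (\<Prod>b\<in>B. card (if b \<in> S then {h b} else Cl b))" by (rule card_PiE[OF B(1)])
      also have "\<dots> = (\<Prod>b\<in>B - A - S. card (Cl b))"
        using B(1) ClA by (intro prod.mono_neutral_cong_right) (auto split: if_splits)
      also have "\<dots> \<le> (\<Prod>b\<in>B - A - S. n)" using ClB(3) by (intro prod_mono) auto
      also have "\<dots> = n ^ (v - card S)"
        unfolding v_def using S B(1) finite_subset[OF S] by (simp add: card_Diff_subset)
      finally show ?thesis .
    qed
    have "{z \<in> \<Omega> \<times> \<Omega>. agree (fst z) (snd z) = S} = (SIGMA h:\<Omega>. {h' \<in> \<Omega>. agree h h' = S})" by auto
    then have "card {z \<in> \<Omega> \<times> \<Omega>. agree (fst z) (snd z) = S} = (\<Sum>h\<in>\<Omega>. card {h' \<in> \<Omega>. agree h h' = S})"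
      using fin\<Omega> by (simp add: card_SigmaI)
    also have "\<dots> \<le> (\<Sum>h\<in>\<Omega>. n ^ (v - card S))" by (intro sum_mono each)
    also have "\<dots> = card \<Omega> * n ^ (v - card S)" by simp
    finally have "real (card {z \<in> \<Omega> \<times> \<Omega>. agree (fst z) (snd z) = S}) \<le> real (card \<Omega> * n ^ (v - card S))"
      by (rule of_nat_mono)
    then show ?thesis by simp
  qed
  let ?N = "{(h, h'). (h, h') \<in> \<Omega> \<times> \<Omega> \<and> (`) h ` E1 \<inter> (`) h' ` E1 \<noteq> {}}"
  let ?SS = "Pow (B - A) - {{}}"
  have "(\<Sum>(h, h')\<in>?N. p ^ card ((`) h ` E1 \<union> (`) h' ` E1))
      \<le> (\<Sum>S\<in>?SS. \<Sum>z\<in>{z \<in> \<Omega> \<times> \<Omega>. agree (fst z) (snd z) = S}. p ^ (2 * k) * real n powr (\<alpha> * real (eS S)))"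
  proof -
    have "(\<Sum>(h, h')\<in>?N. p ^ card ((`) h ` E1 \<union> (`) h' ` E1))
        \<le> (\<Sum>(h, h')\<in>?N. p ^ (2 * k) * real n powr (\<alpha> * real (eS (agree h h'))))"
    proof (rule sum_mono)
      fix z assume "z \<in> ?N"
      then obtain h h' where "z = (h, h')" "h \<in> \<Omega>" "h' \<in> \<Omega>" by blast
      then show "(case z of (h, h') \<Rightarrow> p ^ card ((`) h ` E1 \<union> (`) h' ` E1))
          \<le> (case z of (h, h') \<Rightarrow> p ^ (2 * k) * real n powr (\<alpha> * real (eS (agree h h'))))"
        using card_union[of h h'] by simp
    qed
    also have "\<dots> \<le> (\<Sum>(h, h')\<in>(\<Union>S\<in>?SS. {z \<in> \<Omega> \<times> \<Omega>. agree (fst z) (snd z) = S}).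
        p ^ (2 * k) * real n powr (\<alpha> * real (eS (agree h h'))))"
    proof (rule sum_mono2)
      show "finite (\<Union>S\<in>?SS. {z \<in> \<Omega> \<times> \<Omega>. agree (fst z) (snd z) = S})"
        using fin\<Omega> B(1) by auto
      show "?N \<subseteq> (\<Union>S\<in>?SS. {z \<in> \<Omega> \<times> \<Omega>. agree (fst z) (snd z) = S})"
      proof
        fix z assume "z \<in> ?N"
        then obtain h h' where *: "z = (h, h')" "h \<in> \<Omega>" "h' \<in> \<Omega>" "(`) h ` E1 \<inter> (`) h' ` E1 \<noteq> {}" by blast
        then have "agree h h' \<in> ?SS" using nonempty[of h h'] unfolding agree_def by auto
        then show "z \<in> (\<Union>S\<in>?SS. {z \<in> \<Omega> \<times> \<Omega>. agree (fst z) (snd z) = S})" using *(1-3) by simp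
      qed
    qed (use p in auto)
    also have "\<dots> = (\<Sum>S\<in>?SS. \<Sum>(h, h')\<in>{z \<in> \<Omega> \<times> \<Omega>. agree (fst z) (snd z) = S}.
        p ^ (2 * k) * real n powr (\<alpha> * real (eS (agree h h'))))"
      using fin\<Omega> B(1) by (intro sum.UNION_disjoint) auto
    also have "\<dots> = (\<Sum>S\<in>?SS. \<Sum>z\<in>{z \<in> \<Omega> \<times> \<Omega>. agree (fst z) (snd z) = S}. p ^ (2 * k) * real n powr (\<alpha> * real (eS S)))"
      by (intro sum.cong) auto
    finally show ?thesis .
  qed
  also have "\<dots> = (\<Sum>S\<in>?SS. real (card {z \<in> \<Omega> \<times> \<Omega>. agree (fst z) (snd z) = S}) * (p ^ (2 * k) * real n powr (\<alpha> * real (eS S))))"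
    by simp
  also have "\<dots> \<le> (\<Sum>S\<in>?SS. real (card \<Omega>) * real n ^ (v - card S) * (p ^ (2 * k) * real n powr (\<alpha> * real (eS S))))"
    using count p by (intro sum_mono mult_right_mono) auto
  also have "\<dots> \<le> (\<Sum>S\<in>?SS. real (card \<Omega>) * p ^ (2 * k) * (real n ^ v * real n powr (- \<gamma>)))"
  proof (intro sum_mono)
    fix S assume S: "S \<in> ?SS"
    have "card S \<le> v" unfolding v_def using S B(1) by (intro card_mono) auto
    then have "real n ^ (v - card S) * real n powr (\<alpha> * real (eS S))
        = real n powr (real v - real (card S) + \<alpha> * real (eS S))"
      using n by (simp add: powr_add of_nat_diff flip: powr_realpow)
    also have "\<dots> \<le> real n powr (real v - \<gamma>)"
      using \<gamma>[of S] S n unfolding eS_def by (intro powr_mono) auto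
    also have "\<dots> = real n ^ v * real n powr (- \<gamma>)"
      using n by (simp add: powr_diff powr_minus divide_inverse powr_realpow)
    finally have "real n ^ (v - card S) * real n powr (\<alpha> * real (eS S)) \<le> real n ^ v * real n powr (- \<gamma>)" .
    then have "(real (card \<Omega>) * p ^ (2 * k)) * (real n ^ (v - card S) * real n powr (\<alpha> * real (eS S)))
      \<le> (real (card \<Omega>) * p ^ (2 * k)) * (real n ^ v * real n powr (- \<gamma>))"
      using p by (intro mult_left_mono) auto
    then show "real (card \<Omega>) * real n ^ (v - card S) * (p ^ (2 * k) * real n powr (\<alpha> * real (eS S)))
      \<le> real (card \<Omega>) * p ^ (2 * k) * (real n ^ v * real n powr (- \<gamma>))" by (simp add: mult_ac)
  qed
  also have "\<dots> = real (card ?SS) * (real (card \<Omega>) * p ^ (2 * k) * (real n ^ v * real n powr (- \<gamma>)))" by simp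
  also have "\<dots> \<le> 2 ^ v * (real (card \<Omega>) * p ^ (2 * k) * (real n ^ v * real n powr (- \<gamma>)))"
  proof (intro mult_right_mono)
    have "card ?SS \<le> card (Pow (B - A))" using B(1) by (intro card_mono) auto
    then have "card ?SS \<le> 2 ^ v" unfolding v_def using B(1) by (simp add: card_Pow)
    then have "real (card ?SS) \<le> real (2 ^ v)" by (rule of_nat_mono)
    then show "real (card ?SS) \<le> 2 ^ v" by simp
  qed (use p in auto)
  finally have \<Delta>: "(\<Sum>(h, h')\<in>?N. p ^ card ((`) h ` E1 \<union> (`) h' ` E1))
      \<le> 2 ^ v * (real (card \<Omega>) * p ^ (2 * k) * (real n ^ v * real n powr (- \<gamma>)))" .
  have "measure_pmf.prob (random_subset E p) {H. real (card {h \<in> \<Omega>. (`) h ` E1 \<subseteq> H}) \<le> real (card \<Omega>) * p ^ k / 2}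
      \<le> 4 * (\<Sum>(h, h')\<in>?N. p ^ card ((`) h ` E1 \<union> (`) h' ` E1)) / (real (card \<Omega>) * p ^ k)\<^sup>2"
  proof (rule second_moment_lower_tail[OF fin fin\<Omega> \<Omega>ne p])
    show "(`) h ` E1 \<subseteq> E" if "h \<in> \<Omega>" for h using FE that unfolding \<Omega>_def by auto
    show "card ((`) h ` E1) = k" if "h \<in> \<Omega>" for h
      unfolding k_def using that unfolding \<Omega>_def
      by (intro card_image_edges[OF inj_on_box[OF disj] E1(1)])
  qed
  also have "\<dots> \<le> 4 * (2 ^ v * (real (card \<Omega>) * p ^ (2 * k) * (real n ^ v * real n powr (- \<gamma>)))) / (real (card \<Omega>) * p ^ k)\<^sup>2"
    using \<Delta> by (intro divide_right_mono mult_left_mono) auto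
  also have "\<dots> = 4 * 2 ^ v * real n ^ v * real n powr (- \<gamma>) / real (card \<Omega>)"
    using \<Omega>pos p by (simp add: power2_eq_square power_mult field_simps)
  also have "\<dots> \<le> 4 * 2 ^ v * real n ^ v * real n powr (- \<gamma>) / (c * real n) ^ v"
    using \<Omega>_ge cn \<Omega>pos by (intro divide_left_mono) auto
  also have "\<dots> = 4 * 2 ^ v / c ^ v * real n powr (- \<gamma>)"
    using n by (simp add: power_mult_distrib)
  finally have main: "measure_pmf.prob (random_subset E p) {H. real (card {h \<in> \<Omega>. (`) h ` E1 \<subseteq> H}) \<le> real (card \<Omega>) * p ^ k / 2}
    \<le> 4 * 2 ^ v / c ^ v * real n powr (- \<gamma>)" .
  \<comment> \<open>The threshold in the statement is at most half the mean, since
    \<open>card \<Omega>\<close> is at least \<open>(c * n) ^ v\<close>.\<close>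
  have "c ^ v / 2 * real n powr (real v - \<alpha> * real k) = (c * real n) ^ v * p ^ k / 2"
  proof -
    have "real n powr (real v - \<alpha> * real k) = real n powr real v * real n powr (- \<alpha> * real k)"
      by (simp flip: powr_add)
    also have "\<dots> = real n ^ v * p ^ k"
      unfolding p_def using n powr_neg_power[of "real n" \<alpha> k] by (simp add: powr_realpow)
    finally show ?thesis by (simp add: power_mult_distrib)
  qed
  also have "\<dots> \<le> real (card \<Omega>) * p ^ k / 2"
    using \<Omega>_ge p by (intro divide_right_mono mult_right_mono) auto
  finally have "{H. real (card {h \<in> \<Omega>. (`) h ` E1 \<subseteq> H}) \<le> c ^ v / 2 * real n powr (real v - \<alpha> * real k)}
    \<subseteq> {H. real (card {h \<in> \<Omega>. (`) h ` E1 \<subseteq> H}) \<le> real (card \<Omega>) * p ^ k / 2}" by auto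
  then have "measure_pmf.prob (random_subset E p)
      {H. real (card {h \<in> \<Omega>. (`) h ` E1 \<subseteq> H}) \<le> c ^ v / 2 * real n powr (real v - \<alpha> * real k)}
    \<le> measure_pmf.prob (random_subset E p) {H. real (card {h \<in> \<Omega>. (`) h ` E1 \<subseteq> H}) \<le> real (card \<Omega>) * p ^ k / 2}"
    by (intro measure_pmf.finite_measure_mono) auto
  then show ?thesis using main unfolding p_def v_def k_def \<Omega>_def by linarith
qed

section \<open>Independent boxes from residue classes\<close>

lemma card_residue_class_ge:
  assumes "q > 0" "r < q" "finite A"
  shows "real n / real q - 2 - real (card A) \<le> real (card {x \<in> {1..n} - A. x mod q = r})"
proof -
  let ?S = "{x \<in> {1..n}. x mod q = r}"
  \<comment> \<open>Starting at \<open>k = 1\<close> avoids the value \<open>0\<close>, which is not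
    a vertex, and stopping before \<open>n div q\<close> keeps \<open>k * q + r\<close> at most
    \<open>n\<close>. The skipped block and the rounding of \<open>n / q\<close> account for the
    \<open>2\<close> in the bound.\<close>
  have "(\<lambda>k. k * q + r) ` {1..<n div q} \<subseteq> ?S"
  proof
    fix x assume "x \<in> (\<lambda>k. k * q + r) ` {1..<n div q}"
    then obtain k where k: "1 \<le> k" "k < n div q" "x = k * q + r" by auto
    have "x < (k + 1) * q" using k assms by simp
    also have "\<dots> \<le> n div q * q" using k by (intro mult_right_mono) auto
    also have "\<dots> \<le> n" by simp
    finally have "x \<le> n" by simp
    moreover have "0 < k * q" using k(1) assms(1) by simp
    then have "1 \<le> x" unfolding k(3) by linarith
    ultimately show "x \<in> ?S" unfolding k(3) using assms(2) by simp
  qed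
  then have "card ((\<lambda>k. k * q + r) ` {1..<n div q}) \<le> card ?S" by (intro card_mono) auto
  moreover have "card ((\<lambda>k. k * q + r) ` {1..<n div q}) = n div q - 1"
    using assms by (subst card_image) (auto intro!: inj_onI)
  ultimately have "n div q - 1 \<le> card ?S" by simp
  moreover have "card ?S - card A \<le> card (?S - A)" using assms(3) by (rule diff_card_le_card_Diff)
  moreover have "?S - A = {x \<in> {1..n} - A. x mod q = r}" by auto
  then have "card (?S - A) = card {x \<in> {1..n} - A. x mod q = r}" by (rule arg_cong)
  moreover have "real n / real q - 1 \<le> real (n div q)"
  proof -
    have "n < (n div q + 1) * q" using dividend_less_div_times[OF assms(1), of n] by simp
    then have "real n < real ((n div q + 1) * q)" by (simp only: of_nat_less_iff)
    then have "real n < (real (n div q) + 1) * real q" by (simp add: algebra_simps)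
    then have "real n / real q < real (n div q) + 1" using assms(1) by (subst pos_divide_less_eq) auto
    then show ?thesis by linarith
  qed
  ultimately show ?thesis by linarith
qed

lemma finite_possible_edges: "finite V \<Longrightarrow> finite (possible_edges s V)"
  unfolding possible_edges_def by (rule finite_subset[of _ "Pow V"]) auto

definition copies :: "nat \<Rightarrow> ('b \<Rightarrow> nat) \<Rightarrow> 'b set \<Rightarrow> 'b set \<Rightarrow> 'b set set \<Rightarrow> nat set set \<Rightarrow> ('b \<Rightarrow> nat) set" where
  "copies n f A B E1 H = {h \<in> B \<rightarrow>\<^sub>E {1..n}. inj_on h B \<and> (\<forall>a\<in>A. h a = f a) \<and> (`) h ` E1 \<subseteq> H}"

lemma finite_copies: "finite B \<Longrightarrow> finite (copies n f A B E1 H)"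
  unfolding copies_def by (rule finite_subset[of _ "B \<rightarrow>\<^sub>E {1..n}"]) (auto intro: finite_PiE)

text \<open>The residue classes modulo \<open>q\<close> provide \<open>M\<close> boxes whose candidate edge sets are disjoint,
  so that the failure probability of a single box is raised to the power \<open>M\<close>.\<close>

lemma few_copies_prob_le:
  fixes n m M s :: nat and f :: "nat \<Rightarrow> nat"
  assumes \<alpha>: "\<alpha> > 0" and A: "A \<subseteq> {..<m}"
    and E1: "E1 \<subseteq> possible_edges s {..<m}" "\<And>e. e \<in> E1 \<Longrightarrow> \<not> e \<subseteq> A"
    and f: "inj_on f A" "f ` A \<subseteq> {1..n}"
    and \<gamma>: "\<And>S. S \<subseteq> {..<m} - A \<Longrightarrow> S \<noteq> {} \<Longrightarrow> \<gamma> \<le> real (card S) - \<alpha> * real (card {e \<in> E1. e \<subseteq> A \<union> S})"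
  defines "q \<equiv> M * m + 1" and "v \<equiv> card ({..<m} - A)"
  assumes n: "n \<ge> 2 * q * (m + 2)"
  shows "measure_pmf.prob (random_subset (possible_edges s {1..n}) (real n powr (- \<alpha>)))
      {H. real (card (copies n f A {..<m} E1 H))
         \<le> (1 / (2 * real q)) ^ v / 2 * real n powr (real v - \<alpha> * real (card E1))}
    \<le> (4 * 2 ^ v / (1 / (2 * real q)) ^ v * real n powr (- \<gamma>)) ^ M"
proof -
  let ?E = "possible_edges s {1..n}"
  let ?x = "(1 / (2 * real q)) ^ v / 2 * real n powr (real v - \<alpha> * real (card E1))"
  have q: "q > 0" unfolding q_def by simp
  have n1: "n \<ge> 1" 
  proof -
    have "1 * 1 \<le> 2 * q * (m + 2)" using q by (intro mult_le_mono) auto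
    then show ?thesis using n by linarith
  qed
  have finA: "finite A" using A finite_subset by blast
  have finE: "finite ?E" by (rule finite_possible_edges) simp
  \<comment> \<open>Vertex \<open>b\<close> of box \<open>i\<close> ranges over the residue class of
    \<open>i * m + b\<close>, while the vertices of \<open>A\<close> keep their prescribed images.
    The summand \<open>1\<close> in \<open>q\<close> keeps the modulus positive when
    \<open>M * m = 0\<close>.\<close>
  define Cl where "Cl i b = (if b \<in> A then {f b} else {x \<in> {1..n} - f ` A. x mod q = i * m + b})" for i b
  define \<Omega> where "\<Omega> i = PiE {..<m} (Cl i)" for i
  \<comment> \<open>The number \<open>(x mod q) div m\<close> recovers the box of a new vertex.
    Requiring at least one new vertex makes these edge sets disjoint for different boxes; the image
    of a pattern edge has one because no edge of \<open>E1\<close> lies inside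
    \<open>A\<close>.\<close>
  define D where "D i = {e \<in> ?E. e - f ` A \<noteq> {} \<and> (\<forall>x \<in> e - f ` A. (x mod q) div m = i)}" for i
  have mod: "i * m + b < q" if "i < M" "b < m" for i b
  proof -
    have "i * m + b < (i + 1) * m" using that by simp
    also have "\<dots> \<le> M * m" using that by (intro mult_right_mono) auto
    finally show ?thesis unfolding q_def by simp
  qed
  have disj: "disjoint_family_on (Cl i) {..<m}" for i
    unfolding disjoint_family_on_def Cl_def using inj_onD[OF f(1)] by auto
  have Cl_sub: "Cl i b \<subseteq> {1..n}" for i b unfolding Cl_def using f(2) by auto
  have \<Omega>_sub: "h \<in> {..<m} \<rightarrow>\<^sub>E {1..n}" "inj_on h {..<m}" "\<forall>a\<in>A. h a = f a" if "h \<in> \<Omega> i" for h i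
  proof -
    show "h \<in> {..<m} \<rightarrow>\<^sub>E {1..n}" using that PiE_mono[of "{..<m}" "Cl i" "\<lambda>_. {1..n}"] Cl_sub unfolding \<Omega>_def by blast
    show "inj_on h {..<m}" using inj_on_box[OF disj] that unfolding \<Omega>_def by blast
    show "\<forall>a\<in>A. h a = f a"
    proof
      fix a assume "a \<in> A"
      then have "h a \<in> Cl i a" using PiE_mem[OF that[unfolded \<Omega>_def]] A by blast
      then show "h a = f a" using \<open>a \<in> A\<close> unfolding Cl_def by simp
    qed
  qed
  have edge: "h ` e \<in> ?E" if h: "h \<in> \<Omega> i" and e: "e \<in> E1" for h e i
  proof -
    have e: "e \<subseteq> {..<m}" "finite e" "card e = s" using e E1(1) unfolding possible_edges_def by auto
    have "h ` e \<subseteq> {1..n}" using PiE_mem[OF \<Omega>_sub(1)[OF h]] e(1) by blast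
    moreover have "card (h ` e) = s"
      using card_image[OF inj_on_subset[OF \<Omega>_sub(2)[OF h] e(1)]] e(3) by simp
    ultimately show ?thesis using e(2) unfolding possible_edges_def by simp
  qed
  have edgeD: "h ` e \<in> D i" if i: "i < M" and h: "h \<in> \<Omega> i" and e: "e \<in> E1" for h e i
  proof -
    have sub: "e \<subseteq> {..<m}" using e E1(1) unfolding possible_edges_def by auto
    have new: "h b \<notin> f ` A" "(h b mod q) div m = i" if "b \<in> e" "b \<notin> A" for b
    proof -
      have b: "b < m" using that sub by auto
      then have "h b \<in> Cl i b" using PiE_mem[OF h[unfolded \<Omega>_def]] by blast
      then show "h b \<notin> f ` A" "(h b mod q) div m = i" using that b unfolding Cl_def by auto
    qed
    obtain b where "b \<in> e" "b \<notin> A" using E1(2)[OF e] by blast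
    then have "h ` e - f ` A \<noteq> {}" using new(1) by blast
    moreover have "(x mod q) div m = i" if x: "x \<in> h ` e - f ` A" for x
    proof -
      obtain b where b: "b \<in> e" "x = h b" using x by blast
      then have "b \<notin> A" using x \<Omega>_sub(3)[OF h] by auto
      then show ?thesis using new(2) b by simp
    qed
    ultimately show ?thesis using edge[OF h e] unfolding D_def by blast
  qed
  \<comment> \<open>The lower bound on \<open>n\<close> makes the loss of at most
    \<open>m + 2\<close> no larger than half of \<open>n / q\<close>.\<close>
  have cl_size: "1 / (2 * real q) * real n \<le> real (card {x \<in> {1..n} - f ` A. x mod q = i * m + b})"
    if "i < M" "b < m" for i b
  proof -
    have "card (f ` A) \<le> m"
      using card_image_le[OF finA, of f] card_mono[OF _ A] by simp
    moreover have "real n / real q - 2 - real (card (f ` A)) \<le> real (card {x \<in> {1..n} - f ` A. x mod q = i * m + b})"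
      using finA mod that q by (intro card_residue_class_ge) auto
    moreover have "real m + 2 \<le> real n / (2 * real q)"
    proof -
      have "real (2 * q * (m + 2)) \<le> real n" using n by (rule of_nat_mono)
      then have "(real m + 2) * (2 * real q) \<le> real n" by (simp add: algebra_simps)
      then show ?thesis using q by (subst pos_le_divide_eq) auto
    qed
    moreover have "real n / real q = real n / (2 * real q) + real n / (2 * real q)" by simp
    moreover have "1 / (2 * real q) * real n = real n / (2 * real q)" by simp
    ultimately show ?thesis by linarith
  qed
  have "measure_pmf.prob (random_subset ?E (real n powr (- \<alpha>)))
      {H. \<forall>i<M. real (card {h \<in> \<Omega> i. (`) h ` E1 \<subseteq> H}) \<le> ?x}
    \<le> (4 * 2 ^ v / (1 / (2 * real q)) ^ v * real n powr (- \<gamma>)) ^ M"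
  proof (rule prob_random_subset_indep_power[where D = D])
    show "finite ?E" by (rule finE)
    show "D i \<subseteq> ?E" for i unfolding D_def by auto
    show "D i \<inter> D j = {}" if "i \<noteq> j" for i j
    proof -
      have False if e: "e \<in> D i" "e \<in> D j" for e
      proof -
        obtain x where "x \<in> e - f ` A" using e(1) unfolding D_def by blast
        then have "x mod q div m = i" "x mod q div m = j" using e unfolding D_def by blast+
        then show False using \<open>i \<noteq> j\<close> by simp
      qed
      then show ?thesis by blast
    qed
    show "real (card {h \<in> \<Omega> i. (`) h ` E1 \<subseteq> H}) \<le> ?x \<longleftrightarrow> real (card {h \<in> \<Omega> i. (`) h ` E1 \<subseteq> H \<inter> D i}) \<le> ?x"
      if "i < M" for i H
    proof -
      have "{h \<in> \<Omega> i. (`) h ` E1 \<subseteq> H} = {h \<in> \<Omega> i. (`) h ` E1 \<subseteq> H \<inter> D i}"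
        using edgeD[OF that] by blast
      then show ?thesis by simp
    qed
    show "measure_pmf.prob (random_subset ?E (real n powr (- \<alpha>))) {H. real (card {h \<in> \<Omega> i. (`) h ` E1 \<subseteq> H}) \<le> ?x}
      \<le> 4 * 2 ^ v / (1 / (2 * real q)) ^ v * real n powr (- \<gamma>)" if i: "i < M" for i
      unfolding \<Omega>_def v_def
    proof (rule box_lower_tail[OF finE n1 \<alpha> _ A _ E1(2) disj])
      show "e \<subseteq> {..<m}" if "e \<in> E1" for e using that E1(1) unfolding possible_edges_def by auto
      show "card (Cl i a) = 1" if "a \<in> A" for a using that unfolding Cl_def by simp
      show "finite (Cl i b)" for b by (rule finite_subset[OF Cl_sub]) simp
      show "1 / (2 * real q) * real n \<le> real (card (Cl i b))" if "b \<in> {..<m} - A" for b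
        using cl_size[OF i] that unfolding Cl_def by auto
      show "card (Cl i b) \<le> n" for b using card_mono[OF _ Cl_sub] by simp
      show "0 < 1 / (2 * real q)" using q by simp
      show "h ` e \<in> ?E" if "h \<in> PiE {..<m} (Cl i)" "e \<in> E1" for h e
        using edge[of h i e] that unfolding \<Omega>_def by blast
    qed (use \<gamma> in auto)
  qed
  moreover have "card {h \<in> \<Omega> i. (`) h ` E1 \<subseteq> H} \<le> card (copies n f A {..<m} E1 H)" for i H
    using \<Omega>_sub by (intro card_mono finite_copies) (auto simp: copies_def)
  then have "{H. real (card (copies n f A {..<m} E1 H)) \<le> ?x}
      \<subseteq> {H. \<forall>i<M. real (card {h \<in> \<Omega> i. (`) h ` E1 \<subseteq> H}) \<le> ?x}"
    by (auto intro: order_trans[rotated] of_nat_mono)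
  then have "measure_pmf.prob (random_subset ?E (real n powr (- \<alpha>))) {H. real (card (copies n f A {..<m} E1 H)) \<le> ?x}
      \<le> measure_pmf.prob (random_subset ?E (real n powr (- \<alpha>)))
          {H. \<forall>i<M. real (card {h \<in> \<Omega> i. (`) h ` E1 \<subseteq> H}) \<le> ?x}"
    by (intro measure_pmf.finite_measure_mono) auto
  ultimately show ?thesis by linarith
qed

section \<open>Exact closed extensions\<close>

text \<open>Edges inside \<open>A\<close> are exempt, since the prescribed map \<open>f\<close>
  already decides them.\<close>

definition exact_extension ::
  "real \<Rightarrow> nat \<Rightarrow> nat set \<Rightarrow> nat set \<Rightarrow> nat set set \<Rightarrow> nat hypergraph \<Rightarrow> (nat \<Rightarrow> nat) \<Rightarrow> (nat \<Rightarrow> nat) \<Rightarrow> bool" where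
  "exact_extension \<alpha> t A B E0 H f h \<longleftrightarrow>
     inj_on h B \<and> h ` B \<subseteq> fst H \<and> (\<forall>a\<in>A. h a = f a) \<and>
     (\<forall>e \<subseteq> B. \<not> e \<subseteq> A \<longrightarrow> (h ` e \<in> snd H \<longleftrightarrow> e \<in> E0)) \<and> closed_upto \<alpha> t H (h ` B)"

text \<open>Goodness with \<open>Z = {}\<close> bounds the number of edges that are new over the
  image of \<open>A\<close> by the number in the pattern; the copy already contains that many, so
  there are no others. The relative predimension of the image is then exactly the exponent of the
  pattern, and goodness for the other \<open>Z\<close> becomes closedness.\<close>

lemma exact_extension_of_good_copy:
  assumes \<alpha>: "\<alpha> > 0" and B: "finite B" "A \<subseteq> B" and f: "inj_on f A"
    and E0: "E0 \<subseteq> Pow B"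
    and h: "h \<in> copies n f A B (new_edges E0 A B) H"
    and good: "h \<notin> bad_maps \<alpha> t (predim \<alpha> E0 B - predim \<alpha> E0 A) ({1..n}, H) (f ` A) B"
  shows "exact_extension \<alpha> t A B E0 ({1..n}, H) f h"
proof -
  let ?E1 = "new_edges E0 A B" and ?d = "predim \<alpha> E0 B - predim \<alpha> E0 A"
  have h: "h \<in> B \<rightarrow>\<^sub>E {1..n}" "inj_on h B" "\<forall>a\<in>A. h a = f a" "(`) h ` ?E1 \<subseteq> H"
    using h unfolding copies_def by auto
  have hA: "h ` A = f ` A" using h(3) by (auto simp: image_iff)
  then have sub: "f ` A \<subseteq> h ` B" using B(2) by blast
  have hB: "h ` B \<subseteq> {1..n}" using h(1) by auto
  have fin: "finite (h ` B)" using B(1) by simp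
  have ge: "?d \<le> predim \<alpha> H (h ` B \<union> Z) - predim \<alpha> H (f ` A)" if "Z \<subseteq> {1..n}" "card Z \<le> t" for Z
  proof (rule ccontr)
    assume "\<not> ?thesis"
    then have "h \<in> bad_maps \<alpha> t ?d ({1..n}, H) (f ` A) B"
      unfolding bad_maps_def using h(1) sub that by (auto intro!: exI[of _ Z])
    then show False using good by simp
  qed
  have cardD: "card (h ` B - f ` A) = card (B - A)"
  proof -
    have "h ` B - f ` A = h ` (B - A)"
      using inj_on_image_set_diff[OF h(2) Diff_subset B(2)] hA by simp
    then show ?thesis using card_image[OF inj_on_subset[OF h(2) Diff_subset]] by simp
  qed
  have E1sub: "(`) h ` ?E1 \<subseteq> new_edges H (f ` A) (h ` B)"
  proof
    fix x assume "x \<in> (`) h ` ?E1"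
    then obtain e where e: "e \<in> E0" "e \<subseteq> B" "\<not> e \<subseteq> A" "x = h ` e" "x \<in> H"
      using h(4) unfolding new_edges_def by auto
    then have "\<not> h ` e \<subseteq> h ` A" using inj_on_image_subset_iff[OF h(2), of e A] B(2) by simp
    then show "x \<in> new_edges H (f ` A) (h ` B)" using e hA unfolding new_edges_def by auto
  qed
  have cardE1: "card ((`) h ` ?E1) = card ?E1"
    by (rule card_image_edges[OF h(2)]) (auto simp: new_edges_def)
  have le: "card ?E1 \<le> card (new_edges H (f ` A) (h ` B))"
    using card_mono[OF finite_new_edges[OF fin] E1sub] cardE1 by simp
  have "?d \<le> predim \<alpha> H (h ` B) - predim \<alpha> H (f ` A)" using ge[of "{}"] by simp
  then have "\<alpha> * real (card (new_edges H (f ` A) (h ` B))) \<le> \<alpha> * real (card ?E1)"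
    unfolding predim_diff[OF sub fin] predim_diff[OF B(2,1)] cardD by simp
  then have eqc: "card (new_edges H (f ` A) (h ` B)) = card ?E1" using \<alpha> le by simp
  then have eq: "(`) h ` ?E1 = new_edges H (f ` A) (h ` B)"
    using E1sub cardE1 by (intro card_subset_eq finite_new_edges fin) auto
  have "predim \<alpha> H (h ` B) - predim \<alpha> H (f ` A) = ?d"
    unfolding predim_diff[OF sub fin] predim_diff[OF B(2,1)] cardD eqc ..
  then have "closed_upto \<alpha> t ({1..n}, H) (h ` B)"
    unfolding closed_upto_def 
  proof (intro allI impI)
    fix Z assume "Z \<subseteq> fst ({1..n}, H) \<and> finite Z \<and> card Z \<le> t"
    then have "?d \<le> predim \<alpha> H (h ` B \<union> Z) - predim \<alpha> H (f ` A)" by (intro ge) auto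
    moreover have "predim \<alpha> H (h ` B) - predim \<alpha> H (f ` A) = ?d" by fact
    ultimately show "predim \<alpha> (snd ({1..n}, H)) (h ` B) \<le> predim \<alpha> (snd ({1..n}, H)) (h ` B \<union> Z)" by simp
  qed
  moreover have "h ` e \<in> H \<longleftrightarrow> e \<in> E0" if e: "e \<subseteq> B" "\<not> e \<subseteq> A" for e
  proof
    assume "e \<in> E0"
    then show "h ` e \<in> H" using e h(4) unfolding new_edges_def by auto
  next
    assume "h ` e \<in> H"
    moreover have "\<not> h ` e \<subseteq> h ` A" using inj_on_image_subset_iff[OF h(2), of e A] B(2) e by simp
    ultimately have "h ` e \<in> (`) h ` ?E1"
      unfolding eq using e hA unfolding new_edges_def by auto
    then obtain e' where "e' \<in> E0" "e' \<subseteq> B" "h ` e = h ` e'" unfolding new_edges_def by auto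
    then show "e \<in> E0" using inj_on_image_eq_iff[OF h(2), of e e'] e by simp
  qed
  ultimately show ?thesis
    unfolding exact_extension_def using h(2,3) hB by auto
qed

section \<open>Almost sure properties\<close>

lemma prob_random_hypergraph:
  "measure_pmf.prob (random_hypergraph s n p) {H. Q H}
     = measure_pmf.prob (random_subset (possible_edges s {1..n}) p) {F. Q ({1..n}, F)}"
  unfolding random_hypergraph_eq by (simp add: vimage_def)

lemma holds_almost_surely_iff:
  "holds_almost_surely s p Q \<longleftrightarrow> (\<lambda>n. measure_pmf.prob (random_hypergraph s n (p n)) {H. \<not> Q H}) \<longlonglongrightarrow> 0"
proof -
  have "measure_pmf.prob M {H. \<not> Q H} = 1 - measure_pmf.prob M {H. Q H}" for M
    using measure_pmf.prob_compl[of "{H. Q H}" M] by (simp add: Collect_neg_eq Compl_eq_Diff_UNIV)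
  then have eq: "(\<lambda>n. measure_pmf.prob (random_hypergraph s n (p n)) {H. \<not> Q H})
      = (\<lambda>n. 1 - measure_pmf.prob (random_hypergraph s n (p n)) {H. Q H})" by simp
  show ?thesis
    unfolding holds_almost_surely_def eq
    using tendsto_diff[OF tendsto_const[of 1], of _ 1 sequentially]
      tendsto_diff[OF tendsto_const[of 1], of "\<lambda>n. 1 - measure_pmf.prob (random_hypergraph s n (p n)) {H. Q H}" 0 sequentially]
    by fastforce
qed

lemma holds_almost_surely_mono:
  assumes "holds_almost_surely s p Q" "\<And>n H. H \<in> set_pmf (random_hypergraph s n (p n)) \<Longrightarrow> Q H \<Longrightarrow> R H"
  shows "holds_almost_surely s p R"
  unfolding holds_almost_surely_iff
proof (rule tendsto_sandwich[OF _ _ tendsto_const assms(1)[unfolded holds_almost_surely_iff]])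
  show "\<forall>\<^sub>F n in sequentially. measure_pmf.prob (random_hypergraph s n (p n)) {H. \<not> R H}
      \<le> measure_pmf.prob (random_hypergraph s n (p n)) {H. \<not> Q H}"
  proof (intro always_eventually allI)
    fix n
    have "measure_pmf.prob (random_hypergraph s n (p n)) {H. \<not> R H}
        = measure_pmf.prob (random_hypergraph s n (p n)) ({H. \<not> R H} \<inter> set_pmf (random_hypergraph s n (p n)))"
      by (rule measure_Int_set_pmf[symmetric])
    also have "\<dots> \<le> measure_pmf.prob (random_hypergraph s n (p n)) {H. \<not> Q H}"
      using assms(2) by (intro measure_pmf.finite_measure_mono) auto
    finally show "measure_pmf.prob (random_hypergraph s n (p n)) {H. \<not> R H}
      \<le> measure_pmf.prob (random_hypergraph s n (p n)) {H. \<not> Q H}" .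
  qed
qed simp

lemma holds_almost_surely_conj:
  assumes "holds_almost_surely s p Q" "holds_almost_surely s p R"
  shows "holds_almost_surely s p (\<lambda>H. Q H \<and> R H)"
  unfolding holds_almost_surely_iff
proof (rule tendsto_sandwich[OF _ _ tendsto_const])
  show "(\<lambda>n. measure_pmf.prob (random_hypergraph s n (p n)) {H. \<not> Q H}
      + measure_pmf.prob (random_hypergraph s n (p n)) {H. \<not> R H}) \<longlonglongrightarrow> 0"
    using tendsto_add[OF assms[unfolded holds_almost_surely_iff]] by simp
  show "\<forall>\<^sub>F n in sequentially. measure_pmf.prob (random_hypergraph s n (p n)) {H. \<not> (Q H \<and> R H)}
      \<le> measure_pmf.prob (random_hypergraph s n (p n)) {H. \<not> Q H}
        + measure_pmf.prob (random_hypergraph s n (p n)) {H. \<not> R H}"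
  proof (intro always_eventually allI)
    fix n
    have "{H. \<not> (Q H \<and> R H)} = {H. \<not> Q H} \<union> {H. \<not> R H}" by auto
    then show "measure_pmf.prob (random_hypergraph s n (p n)) {H. \<not> (Q H \<and> R H)}
      \<le> measure_pmf.prob (random_hypergraph s n (p n)) {H. \<not> Q H}
        + measure_pmf.prob (random_hypergraph s n (p n)) {H. \<not> R H}"
      by (simp add: measure_Un_le)
  qed
qed simp

lemma holds_almost_surely_always:
  assumes "\<And>n H. H \<in> set_pmf (random_hypergraph s n (p n)) \<Longrightarrow> Q H"
  shows "holds_almost_surely s p Q"
  by (rule holds_almost_surely_mono[of s p "\<lambda>_. True"]) (use assms in \<open>auto simp: holds_almost_surely_def\<close>)

lemma holds_almost_surely_ball:
  assumes "finite I" "\<And>i. i \<in> I \<Longrightarrow> holds_almost_surely s p (Q i)"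
  shows "holds_almost_surely s p (\<lambda>H. \<forall>i\<in>I. Q i H)"
  using assms
proof (induction I rule: finite_induct)
  case (insert i I)
  then have "holds_almost_surely s p (\<lambda>H. Q i H \<and> (\<forall>i\<in>I. Q i H))"
    by (intro holds_almost_surely_conj) auto
  then show ?case by simp
qed (auto intro: holds_almost_surely_always)

text \<open>A polynomially small failure probability suffices. Restricting the event to sets of
  possible edges is free, as the random set always satisfies it, and makes uniformity available when
  the event is bounded.\<close>

lemma holds_almost_surely_of_bound:
  fixes p :: "nat \<Rightarrow> real"
  assumes "\<epsilon> > 0"
    and "\<And>n. n \<ge> N \<Longrightarrow> measure_pmf.prob (random_subset (possible_edges s {1..n}) (p n))
               {F. F \<subseteq> possible_edges s {1..n} \<and> \<not> Q ({1..n}, F)} \<le> C * real n powr (- \<epsilon>)"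
  shows "holds_almost_surely s p Q"
  unfolding holds_almost_surely_iff prob_random_hypergraph
proof (rule tendsto_sandwich[OF _ _ tendsto_const])
  show "(\<lambda>n. C * real n powr (- \<epsilon>)) \<longlonglongrightarrow> 0"
    using tendsto_mult[OF tendsto_const[of C] tendsto_neg_powr[of "- \<epsilon>", OF _ filterlim_real_sequentially]] assms(1)
    by simp
  have "measure_pmf.prob (random_subset (possible_edges s {1..n}) (p n)) {F. \<not> Q ({1..n}, F)}
      \<le> C * real n powr (- \<epsilon>)" if "n \<ge> N" for n
  proof -
    let ?M = "random_subset (possible_edges s {1..n}) (p n)"
    have "measure_pmf.prob ?M {F. \<not> Q ({1..n}, F)} = measure_pmf.prob ?M ({F. \<not> Q ({1..n}, F)} \<inter> set_pmf ?M)"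
      by (rule measure_Int_set_pmf[symmetric])
    also have "\<dots> \<le> measure_pmf.prob ?M {F. F \<subseteq> possible_edges s {1..n} \<and> \<not> Q ({1..n}, F)}"
      using set_random_subset[of "possible_edges s {1..n}" "p n"]
      by (intro measure_pmf.finite_measure_mono) auto
    finally show ?thesis using assms(2)[OF that] by linarith
  qed
  then show "\<forall>\<^sub>F n in sequentially. measure_pmf.prob (random_subset (possible_edges s {1..n}) (p n)) {F. \<not> Q ({1..n}, F)}
      \<le> C * real n powr (- \<epsilon>)"
    using eventually_sequentially by blast
qed simp

section \<open>Almost sure sparsity and extension properties\<close>

lemma predim_empty:
  assumes "s > 0" "F \<subseteq> possible_edges s V"
  shows "predim \<alpha> F {} = 0"
proof -
  have "{e \<in> F. e \<subseteq> {}} = {}" using assms unfolding possible_edges_def by auto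
  then show ?thesis unfolding predim_def ecount_def by simp
qed

text \<open>By the gap, a small set of negative predimension has predimension at most
  \<open>- \<epsilon>\<close> and is thus a low extension of the empty set with
  \<open>c = - \<epsilon>\<close>. The first moment bound makes even one such set unlikely.\<close>

lemma small_sets_nonneg_predim:
  assumes \<alpha>: "\<alpha> > 0" and s: "s > 0"
  shows "holds_almost_surely s (\<lambda>n. real n powr (- \<alpha>)) (\<lambda>H. \<forall>W \<subseteq> fst H. card W \<le> L \<longrightarrow> 0 \<le> predim \<alpha> (snd H) W)"
proof -
  obtain \<epsilon> where \<epsilon>: "0 < \<epsilon>" "\<And>v e :: nat. v \<le> L \<Longrightarrow> real v - \<alpha> * real e < 0 \<Longrightarrow> real v - \<alpha> * real e \<le> 0 - \<epsilon>"
    using predim_gap[OF \<alpha>, of L 0] by metis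
  show ?thesis
  proof (rule holds_almost_surely_of_bound[OF \<epsilon>(1), of 1])
    fix n :: nat assume n: "n \<ge> 1"
    let ?E = "possible_edges s {1..n}"
    let ?M = "random_subset ?E (real n powr (- \<alpha>))"
    let ?P = "\<lambda>F. \<forall>W \<subseteq> fst ({1..n}, F). card W \<le> L \<longrightarrow> 0 \<le> predim \<alpha> (snd ({1..n}, F)) W"
    have "{F. F \<subseteq> ?E \<and> \<not> ?P F} \<subseteq> {F. 1 \<le> real (card (low_extensions \<alpha> L (- \<epsilon>) ({1..n}, F) {}))}"
    proof
      fix F assume "F \<in> {F. F \<subseteq> ?E \<and> \<not> ?P F}"
      then obtain W where F: "F \<subseteq> ?E" and W: "W \<subseteq> {1..n}" "card W \<le> L" "predim \<alpha> F W < 0" by auto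
      have "predim \<alpha> F W \<le> - \<epsilon>"
        using \<epsilon>(2)[of "card W" "ecount F W"] W unfolding predim_def by simp
      then have "W \<in> low_extensions \<alpha> L (- \<epsilon>) ({1..n}, F) {}"
        using W predim_empty[OF s F, of \<alpha>] unfolding low_extensions_def by simp
      moreover have "finite (low_extensions \<alpha> L (- \<epsilon>) ({1..n}, F) {})"
        by (rule finite_low_extensions) simp
      ultimately have "0 < card (low_extensions \<alpha> L (- \<epsilon>) ({1..n}, F) {})"
        by (metis card_gt_0_iff empty_iff)
      then show "F \<in> {F. 1 \<le> real (card (low_extensions \<alpha> L (- \<epsilon>) ({1..n}, F) {}))}" by simp
    qed
    then have "measure_pmf.prob ?M {F. F \<subseteq> ?E \<and> \<not> ?P F}
        \<le> measure_pmf.prob ?M {F. 1 \<le> real (card (low_extensions \<alpha> L (- \<epsilon>) ({1..n}, F) {}))}"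
      by (intro measure_pmf.finite_measure_mono) auto
    also have "\<dots> \<le> (real L + 1) * 2 ^ (2 ^ (0 + L)) * real n powr (- \<epsilon>) / 1"
      using n \<alpha> by (intro prob_low_extensions_ge_le finite_possible_edges) auto
    finally show "measure_pmf.prob ?M {F. F \<subseteq> ?E \<and> \<not> ?P F} \<le> ((real L + 1) * 2 ^ (2 ^ (0 + L))) * real n powr (- \<epsilon>)"
      by simp
  qed
qed

text \<open>\<open>T\<close> is the closedness demanded of the base and \<open>t\<close> the
  closedness delivered for the extension; the back and forth argument gives up some of it at every
  quantifier.\<close>

definition generic_extensions ::
  "real \<Rightarrow> nat \<Rightarrow> nat \<Rightarrow> nat set \<Rightarrow> nat set \<Rightarrow> nat set set \<Rightarrow> nat hypergraph \<Rightarrow> bool" where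
  "generic_extensions \<alpha> t T A B E0 H \<longleftrightarrow>
     (\<forall>f. inj_on f A \<and> f ` A \<subseteq> fst H \<and> closed_upto \<alpha> T H (f ` A) \<longrightarrow>
        (\<exists>h. exact_extension \<alpha> t A B E0 H f h))"

lemma exact_extension_cong:
  "(\<And>a. a \<in> A \<Longrightarrow> f a = g a) \<Longrightarrow> exact_extension \<alpha> t A B E0 H f h \<longleftrightarrow> exact_extension \<alpha> t A B E0 H g h"
  unfolding exact_extension_def by simp

text \<open>If the copies exceed a threshold in number and the bad maps stay below it, some copy is
  not bad, hence exact and closed. The exponent \<open>card A + 1\<close> beats the number of maps
  \<open>f\<close> on \<open>A\<close>, at most \<open>n ^ card A\<close>, by one factor
  \<open>n\<close>.\<close>

lemma no_exact_extension_prob_le: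
  fixes m s t T :: nat and A :: "nat set"
  assumes \<alpha>: "\<alpha> > 0" and A: "A \<subseteq> {..<m}" and E0: "E0 \<subseteq> possible_edges s {..<m}"
    and safe: "\<And>S. A \<subset> S \<Longrightarrow> S \<subseteq> {..<m} \<Longrightarrow> predim \<alpha> E0 A < predim \<alpha> E0 S"
    and T: "m - card A + t \<le> T"
  shows "\<exists>C N. \<forall>n f. n \<ge> N \<longrightarrow> n \<ge> 1 \<longrightarrow> inj_on f A \<longrightarrow> f ` A \<subseteq> {1..n} \<longrightarrow>
      measure_pmf.prob (random_subset (possible_edges s {1..n}) (real n powr (- \<alpha>)))
        {H. closed_upto \<alpha> T ({1..n}, H) (f ` A) \<and> (\<nexists>h. exact_extension \<alpha> t A {..<m} E0 ({1..n}, H) f h)}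
      \<le> C * real n powr (- real (card A + 1))"
proof -
  let ?B = "{..<m}"
  define a where "a = card A"
  define E1 where "E1 = new_edges E0 A ?B"
  define v where "v = card (?B - A)"
  define d where "d = predim \<alpha> E0 ?B - predim \<alpha> E0 A"
  have d: "d = real v - \<alpha> * real (card E1)"
    unfolding d_def v_def E1_def using A by (intro predim_diff) auto
  have finA: "finite A" using A finite_subset by blast
  have E1: "E1 \<subseteq> possible_edges s ?B" "\<And>e. e \<in> E1 \<Longrightarrow> \<not> e \<subseteq> A" unfolding E1_def new_edges_def using E0 by auto
  define g where "g S = real (card S) - \<alpha> * real (card {e \<in> E1. e \<subseteq> A \<union> S})" for S
  \<comment> \<open>The least gain of a nonempty partial extension, positive by \<open>safe\<close>;
    the inserted \<open>1\<close> covers a pattern without new vertices.\<close>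
  define \<gamma> where "\<gamma> = Min (insert 1 (g ` (Pow (?B - A) - {{}})))"
  have fing: "finite (insert 1 (g ` (Pow (?B - A) - {{}})))" by simp
  have gpos: "0 < g S" if S: "S \<subseteq> ?B - A" "S \<noteq> {}" for S
  proof -
    have "predim \<alpha> E0 (A \<union> S) - predim \<alpha> E0 A = real (card (A \<union> S - A)) - \<alpha> * real (card (new_edges E0 A (A \<union> S)))"
      using finA S finite_subset[of S ?B] by (intro predim_diff) auto
    moreover have "A \<union> S - A = S" using S by auto
    moreover have "new_edges E0 A (A \<union> S) = {e \<in> E1. e \<subseteq> A \<union> S}"
      unfolding E1_def new_edges_def using S A by auto
    moreover have "predim \<alpha> E0 A < predim \<alpha> E0 (A \<union> S)" using S A by (intro safe) auto
    ultimately show ?thesis unfolding g_def by simp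
  qed
  have \<gamma>: "0 < \<gamma>" unfolding \<gamma>_def using gpos by (subst Min_gr_iff[OF fing]) auto
  have \<gamma>_le: "\<gamma> \<le> real (card S) - \<alpha> * real (card {e \<in> E1. e \<subseteq> A \<union> S})" if "S \<subseteq> ?B - A" "S \<noteq> {}" for S
    unfolding g_def[symmetric] \<gamma>_def using that by (intro Min_le[OF fing]) auto
  obtain \<epsilon> where \<epsilon>: "0 < \<epsilon>" "\<And>v e :: nat. v \<le> m + t \<Longrightarrow> real v - \<alpha> * real e < d \<Longrightarrow> real v - \<alpha> * real e \<le> d - \<epsilon>"
    using predim_gap[OF \<alpha>, of "m + t" d] by metis
  \<comment> \<open>With \<open>M\<close> boxes too few copies have probability of order
    \<open>n powr (- \<gamma> * M)\<close>, and with \<open>K\<close>-th moments too many bad maps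
    have probability of order \<open>n powr (- (K * \<epsilon>))\<close>; both are brought down to
    \<open>n powr (- (a + 1))\<close>.\<close>
  obtain M :: nat where M: "real a + 1 \<le> real M * \<gamma>" using \<gamma> reals_Archimedean3 less_imp_le by metis
  obtain K :: nat where K: "real a + 1 \<le> real K * \<epsilon>" using \<epsilon>(1) reals_Archimedean3 less_imp_le by metis
  define q where "q = M * m + 1"
  define c where "c = 1 / (2 * real q)"
  have "q > 0" unfolding q_def by simp
  then have c: "c > 0" unfolding c_def by simp
  define L where "L = K * (m + t)"
  define C1 where "C1 = (4 * 2 ^ v / c ^ v) ^ M"
  define C2 where "C2 = (real L + 1) * 2 ^ (2 ^ (a + L)) * (1 + real a + real L) ^ (m * K) / (c ^ v / 2) ^ K"
  have C: "0 \<le> C1" "0 \<le> C2" unfolding C1_def C2_def using c by auto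
  have main: "measure_pmf.prob (random_subset (possible_edges s {1..n}) (real n powr (- \<alpha>)))
        {H. closed_upto \<alpha> T ({1..n}, H) (f ` A) \<and> (\<nexists>h. exact_extension \<alpha> t A ?B E0 ({1..n}, H) f h)}
      \<le> (C1 + C2) * real n powr (- real (card A + 1))"
    if n: "n \<ge> 2 * q * (m + 2)" "n \<ge> 1" and f: "inj_on f A" "f ` A \<subseteq> {1..n}" for n f
  proof -
    let ?M = "random_subset (possible_edges s {1..n}) (real n powr (- \<alpha>))"
    define x where "x = c ^ v / 2 * real n powr d"
    have x: "x > 0" unfolding x_def using c n by simp
    let ?few = "{H. real (card (copies n f A ?B E1 H)) \<le> x}"
    let ?bad = "{H. closed_upto \<alpha> T ({1..n}, H) (f ` A) \<and> x \<le> real (card (bad_maps \<alpha> t d ({1..n}, H) (f ` A) ?B))}"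
    have cardfA: "card (f ` A) = a" unfolding a_def using f(1) by (rule card_image)
    have "{H. closed_upto \<alpha> T ({1..n}, H) (f ` A) \<and> (\<nexists>h. exact_extension \<alpha> t A ?B E0 ({1..n}, H) f h)} \<subseteq> ?few \<union> ?bad"
    proof (intro subsetI, rule ccontr)
      fix H assume H: "H \<in> {H. closed_upto \<alpha> T ({1..n}, H) (f ` A) \<and> (\<nexists>h. exact_extension \<alpha> t A ?B E0 ({1..n}, H) f h)}"
        and not: "H \<notin> ?few \<union> ?bad"
      have "card (bad_maps \<alpha> t d ({1..n}, H) (f ` A) ?B) < card (copies n f A ?B E1 H)"
        using H not by auto
      moreover have "finite (bad_maps \<alpha> t d ({1..n}, H) (f ` A) ?B)"
        unfolding bad_maps_def by (rule finite_subset[of _ "?B \<rightarrow>\<^sub>E {1..n}"]) (auto intro: finite_PiE)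
      ultimately have "\<not> copies n f A ?B E1 H \<subseteq> bad_maps \<alpha> t d ({1..n}, H) (f ` A) ?B"
        using card_mono by (metis leD)
      then obtain h where h: "h \<in> copies n f A ?B E1 H" "h \<notin> bad_maps \<alpha> t d ({1..n}, H) (f ` A) ?B" by blast
      have "exact_extension \<alpha> t A ?B E0 ({1..n}, H) f h"
        using E0 h unfolding E1_def d_def
        by (intro exact_extension_of_good_copy[OF \<alpha> _ A f(1)]) (auto simp: possible_edges_def)
      then show False using H by blast
    qed
    then have "measure_pmf.prob ?M {H. closed_upto \<alpha> T ({1..n}, H) (f ` A) \<and> (\<nexists>h. exact_extension \<alpha> t A ?B E0 ({1..n}, H) f h)}
        \<le> measure_pmf.prob ?M (?few \<union> ?bad)"
      by (intro measure_pmf.finite_measure_mono) auto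
    also have "\<dots> \<le> measure_pmf.prob ?M ?few + measure_pmf.prob ?M ?bad"
      by (intro measure_Un_le) auto
    also have "measure_pmf.prob ?M ?few \<le> C1 * real n powr (- real (a + 1))"
    proof -
      have "measure_pmf.prob ?M ?few \<le> (4 * 2 ^ v / c ^ v * real n powr (- \<gamma>)) ^ M"
        unfolding x_def d c_def v_def q_def
        by (rule few_copies_prob_le[OF \<alpha> A E1 f \<gamma>_le n(1)[unfolded q_def]])
      also have "\<dots> = C1 * real n powr (- \<gamma> * real M)"
        unfolding C1_def power_mult_distrib using n by (simp add: powr_neg_power[of "real n" \<gamma> M])
      also have "\<dots> \<le> C1 * real n powr (- real (a + 1))"
        using C n M by (intro mult_left_mono powr_mono) (auto simp: mult_ac)
      finally show ?thesis .
    qed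
    also have "measure_pmf.prob ?M ?bad \<le> C2 * real n powr (- real (a + 1))"
    proof -
      have "measure_pmf.prob ?M ?bad \<le> (real (K * (card ?B + t)) + 1) * 2 ^ (2 ^ (a + K * (card ?B + t)))
          * (1 + real a + real (K * (card ?B + t))) ^ (card ?B * K) * real n powr (real K * (d - \<epsilon>)) / x ^ K"
        by (rule prob_many_bad_maps_le)
          (use n \<alpha> f cardfA T x \<epsilon>(2) in \<open>auto simp: finite_possible_edges a_def\<close>)
      also have "\<dots> = (real L + 1) * 2 ^ (2 ^ (a + L)) * (1 + real a + real L) ^ (m * K) * real n powr (real K * (d - \<epsilon>)) / x ^ K"
        unfolding L_def by simp
      also have "\<dots> = C2 * (real n powr (real K * (d - \<epsilon>)) / (real n powr d) ^ K)"
        unfolding C2_def x_def power_mult_distrib by simp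
      \<comment> \<open>The threshold \<open>x\<close> is of order \<open>n powr d\<close>, so its
        \<open>K\<close>-th power cancels the main term of the moment and leaves a gain of
        \<open>\<epsilon>\<close> for each of the \<open>K\<close> maps.\<close>
      also have "real n powr (real K * (d - \<epsilon>)) / (real n powr d) ^ K = real n powr (- (real K * \<epsilon>))"
      proof -
        have "(real n powr d) ^ K = real n powr (real K * d)"
          using n by (subst powr_power) (auto simp: mult_ac)
        then have "real n powr (real K * (d - \<epsilon>)) / (real n powr d) ^ K = real n powr (real K * (d - \<epsilon>) - real K * d)"
          by (simp only: powr_diff)
        then show ?thesis by (simp add: right_diff_distrib)
      qed
      also have "C2 * \<dots> \<le> C2 * real n powr (- real (a + 1))"
        using C n K by (intro mult_left_mono powr_mono) auto
      finally show ?thesis .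
    qed
    finally show ?thesis unfolding a_def by (simp add: algebra_simps)
  qed
  show ?thesis using main by blast
qed

theorem generic_extensions_almost_surely:
  fixes m s t T :: nat and A :: "nat set"
  assumes \<alpha>: "\<alpha> > 0" and A: "A \<subseteq> {..<m}" and E0: "E0 \<subseteq> possible_edges s {..<m}"
    and safe: "\<And>S. A \<subset> S \<Longrightarrow> S \<subseteq> {..<m} \<Longrightarrow> predim \<alpha> E0 A < predim \<alpha> E0 S"
    and T: "m - card A + t \<le> T"
  shows "holds_almost_surely s (\<lambda>n. real n powr (- \<alpha>)) (generic_extensions \<alpha> t T A {..<m} E0)"
proof -
  obtain C N where CN: "\<And>n f. n \<ge> N \<Longrightarrow> n \<ge> 1 \<Longrightarrow> inj_on f A \<Longrightarrow> f ` A \<subseteq> {1..n} \<Longrightarrow>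
      measure_pmf.prob (random_subset (possible_edges s {1..n}) (real n powr (- \<alpha>)))
        {H. closed_upto \<alpha> T ({1..n}, H) (f ` A) \<and> (\<nexists>h. exact_extension \<alpha> t A {..<m} E0 ({1..n}, H) f h)}
      \<le> C * real n powr (- real (card A + 1))"
    using no_exact_extension_prob_le[OF assms] by blast
  have finA: "finite A" using A finite_subset by blast
  show ?thesis
  proof (rule holds_almost_surely_of_bound[of 1 "max 1 N"])
    fix n assume "n \<ge> max 1 N"
    then have n: "n \<ge> N" "n \<ge> 1" by auto
    let ?M = "random_subset (possible_edges s {1..n}) (real n powr (- \<alpha>))"
    let ?fail = "\<lambda>f. {H. closed_upto \<alpha> T ({1..n}, H) (f ` A) \<and> (\<nexists>h. exact_extension \<alpha> t A {..<m} E0 ({1..n}, H) f h)}"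
    \<comment> \<open>Only the values of \<open>f\<close> on \<open>A\<close> matter, so restricting
      the maps to \<open>A\<close> leaves a finite family for the union bound.\<close>
    define \<Phi> where "\<Phi> = {f \<in> A \<rightarrow>\<^sub>E {1..n}. inj_on f A}"
    have fin\<Phi>: "finite \<Phi>" unfolding \<Phi>_def using finA by (simp add: finite_PiE)
    have "{F. F \<subseteq> possible_edges s {1..n} \<and> \<not> generic_extensions \<alpha> t T A {..<m} E0 ({1..n}, F)} \<subseteq> (\<Union>f\<in>\<Phi>. ?fail f)"
    proof
      fix F assume "F \<in> {F. F \<subseteq> possible_edges s {1..n} \<and> \<not> generic_extensions \<alpha> t T A {..<m} E0 ({1..n}, F)}"
      then obtain f where f: "inj_on f A" "f ` A \<subseteq> {1..n}" "closed_upto \<alpha> T ({1..n}, F) (f ` A)"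
          "\<nexists>h. exact_extension \<alpha> t A {..<m} E0 ({1..n}, F) f h"
        unfolding generic_extensions_def by auto
      have "restrict f A \<in> \<Phi>" unfolding \<Phi>_def using f(1,2) by (auto simp: inj_on_def)
      moreover have "F \<in> ?fail (restrict f A)"
        using f(3,4) exact_extension_cong[of A "restrict f A" f] by simp
      ultimately show "F \<in> (\<Union>f\<in>\<Phi>. ?fail f)" by blast
    qed
    then have "measure_pmf.prob ?M {F. F \<subseteq> possible_edges s {1..n} \<and> \<not> generic_extensions \<alpha> t T A {..<m} E0 ({1..n}, F)}
        \<le> measure_pmf.prob ?M (\<Union>f\<in>\<Phi>. ?fail f)"
      by (intro measure_pmf.finite_measure_mono) auto
    also have "\<dots> \<le> (\<Sum>f\<in>\<Phi>. measure_pmf.prob ?M (?fail f))"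
      by (intro measure_pmf.finite_measure_subadditive_finite fin\<Phi>) auto
    also have "\<dots> \<le> (\<Sum>f\<in>\<Phi>. \<bar>C\<bar> * real n powr (- real (card A + 1)))"
    proof (rule sum_mono)
      fix f assume "f \<in> \<Phi>"
      then have "measure_pmf.prob ?M (?fail f) \<le> C * real n powr (- real (card A + 1))"
        unfolding \<Phi>_def by (intro CN n) auto
      also have "\<dots> \<le> \<bar>C\<bar> * real n powr (- real (card A + 1))" by (intro mult_right_mono) auto
      finally show "measure_pmf.prob ?M (?fail f) \<le> \<bar>C\<bar> * real n powr (- real (card A + 1))" .
    qed
    also have "\<dots> = real (card \<Phi>) * (\<bar>C\<bar> * real n powr (- real (card A + 1)))" by simp
    also have "\<dots> \<le> real n ^ card A * (\<bar>C\<bar> * real n powr (- real (card A + 1)))"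
    proof (rule mult_right_mono)
      have "card \<Phi> \<le> card (A \<rightarrow>\<^sub>E {1..n})" unfolding \<Phi>_def using finA by (intro card_mono finite_PiE) auto
      also have "\<dots> = n ^ card A" using finA by (simp add: card_PiE)
      finally have "real (card \<Phi>) \<le> real (n ^ card A)" by (rule of_nat_mono)
      then show "real (card \<Phi>) \<le> real n ^ card A" by simp
    qed simp
    also have "\<dots> = \<bar>C\<bar> * (real n powr real (card A) * real n powr (- real (card A + 1)))"
      using n by (simp add: powr_realpow)
    also have "\<dots> = \<bar>C\<bar> * real n powr (- 1)" by (simp flip: powr_add)
    finally show "measure_pmf.prob ?M {F. F \<subseteq> possible_edges s {1..n} \<and> \<not> generic_extensions \<alpha> t T A {..<m} E0 ({1..n}, F)}
      \<le> \<bar>C\<bar> * real n powr (- 1)" .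
  qed simp
qed

text \<open>Patterns live on initial segments \<open>{..<m}\<close> with \<open>m \<le> N\<close>,
  so finitely many codes \<open>(m, A, E0)\<close> represent all small patterns up to renaming, and
  a finite conjunction of almost sure properties suffices.\<close>

definition rich :: "real \<Rightarrow> nat \<Rightarrow> nat \<Rightarrow> nat \<Rightarrow> nat \<Rightarrow> nat hypergraph \<Rightarrow> bool" where
  "rich \<alpha> s N t T H \<longleftrightarrow>
     (\<forall>m A E0. m \<le> N \<and> A \<subseteq> {..<m} \<and> E0 \<subseteq> possible_edges s {..<m} \<and> m - card A + t \<le> T \<and>
        (\<forall>S. A \<subset> S \<longrightarrow> S \<subseteq> {..<m} \<longrightarrow> predim \<alpha> E0 A < predim \<alpha> E0 S) \<longrightarrow>
        generic_extensions \<alpha> t T A {..<m} E0 H)"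

lemma rich_almost_surely:
  assumes "\<alpha> > 0"
  shows "holds_almost_surely s (\<lambda>n. real n powr (- \<alpha>)) (rich \<alpha> s N t T)"
proof -
  let ?I = "{(m, A, E0). m \<le> N \<and> A \<subseteq> {..<m} \<and> E0 \<subseteq> possible_edges s {..<m} \<and> m - card A + t \<le> T \<and>
        (\<forall>S. A \<subset> S \<longrightarrow> S \<subseteq> {..<m} \<longrightarrow> predim \<alpha> E0 A < predim \<alpha> E0 S)}"
  have "?I \<subseteq> {..N} \<times> Pow {..<N} \<times> Pow (Pow {..<N})"
    unfolding possible_edges_def by fastforce
  then have "finite ?I" by (rule finite_subset) auto
  then have "holds_almost_surely s (\<lambda>n. real n powr (- \<alpha>))
      (\<lambda>H. \<forall>i\<in>?I. case i of (m, A, E0) \<Rightarrow> generic_extensions \<alpha> t T A {..<m} E0 H)"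
  proof (rule holds_almost_surely_ball)
    fix i assume i: "i \<in> ?I"
    obtain m A E0 where eq: "i = (m, A, E0)" by (cases i)
    have *: "A \<subseteq> {..<m}" "E0 \<subseteq> possible_edges s {..<m}" "m - card A + t \<le> T"
        "\<And>S. A \<subset> S \<Longrightarrow> S \<subseteq> {..<m} \<Longrightarrow> predim \<alpha> E0 A < predim \<alpha> E0 S"
      using i unfolding eq by simp_all
    have "holds_almost_surely s (\<lambda>n. real n powr (- \<alpha>)) (generic_extensions \<alpha> t T A {..<m} E0)"
      by (rule generic_extensions_almost_surely[OF assms *(1,2,4,3)])
    then show "holds_almost_surely s (\<lambda>n. real n powr (- \<alpha>))
        (\<lambda>H. case i of (m, A, E0) \<Rightarrow> generic_extensions \<alpha> t T A {..<m} E0 H)" by (simp add: eq)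
  qed
  then show ?thesis
    by (rule holds_almost_surely_mono) (auto simp: rich_def)
qed

section \<open>Back and forth between closed sets\<close>

lemma predim_image:
  assumes "inj_on g B" "S \<subseteq> B" "\<And>e. e \<subseteq> B \<Longrightarrow> e \<in> E \<longleftrightarrow> g ` e \<in> E'"
  shows "predim \<alpha> E' (g ` S) = predim \<alpha> E S"
proof -
  have inj: "inj_on g S" using assms(1,2) inj_on_subset by blast
  have "{e \<in> E'. e \<subseteq> g ` S} = (`) g ` {e \<in> E. e \<subseteq> S}"
  proof (intro equalityI subsetI)
    fix e assume "e \<in> {e \<in> E'. e \<subseteq> g ` S}"
    then obtain e' where "e' \<subseteq> S" "e = g ` e'" "e \<in> E'" by (auto simp: subset_image_iff)
    then show "e \<in> (`) g ` {e \<in> E. e \<subseteq> S}" using assms(2) assms(3)[of e'] by auto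
  next
    fix e assume "e \<in> (`) g ` {e \<in> E. e \<subseteq> S}"
    then obtain e' where "e' \<in> E" "e' \<subseteq> S" "e = g ` e'" by blast
    then show "e \<in> {e \<in> E'. e \<subseteq> g ` S}" using assms(2) assms(3)[of e'] by auto
  qed
  then have "ecount E' (g ` S) = ecount E S"
    unfolding ecount_def using card_image_edges[OF inj, of "{e \<in> E. e \<subseteq> S}"] by simp
  then show ?thesis unfolding predim_def by (simp add: card_image[OF inj])
qed

definition local_iso ::
  "real \<Rightarrow> nat \<Rightarrow> nat \<Rightarrow> 'a hypergraph \<Rightarrow> 'b hypergraph \<Rightarrow> 'a set \<Rightarrow> ('a \<Rightarrow> 'b) \<Rightarrow> bool" where
  "local_iso \<alpha> t R H H' A f \<longleftrightarrow>
     finite A \<and> card A \<le> R \<and> A \<subseteq> fst H \<and> closed_upto \<alpha> t H A \<and>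
     inj_on f A \<and> f ` A \<subseteq> fst H' \<and> closed_upto \<alpha> t H' (f ` A) \<and>
     (\<forall>e \<subseteq> A. e \<in> snd H \<longleftrightarrow> f ` e \<in> snd H')"

lemma local_iso_sym:
  assumes "local_iso \<alpha> t R H H' A f"
  shows "local_iso \<alpha> t R H' H (f ` A) (inv_into A f)"
proof -
  have inj: "inj_on f A" and edges: "\<And>e. e \<subseteq> A \<Longrightarrow> e \<in> snd H \<longleftrightarrow> f ` e \<in> snd H'"
    using assms unfolding local_iso_def by auto
  have "e \<in> snd H' \<longleftrightarrow> inv_into A f ` e \<in> snd H" if "e \<subseteq> f ` A" for e
  proof -
    have "inv_into A f ` e \<subseteq> A" using that inv_into_into[of _ f A] by blast
    moreover have "f ` inv_into A f ` e = e" using that by (rule image_inv_into_cancel[OF refl])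
    ultimately show ?thesis using edges[of "inv_into A f ` e"] by simp
  qed
  moreover have "inv_into A f ` f ` A = A" using inj by (simp add: inv_into_image_cancel)
  ultimately show ?thesis
    using assms card_image[OF inj] unfolding local_iso_def by (simp add: inj_on_inv_into)
qed

lemma local_iso_mono: "local_iso \<alpha> t R H H' A f \<Longrightarrow> t' \<le> t \<Longrightarrow> local_iso \<alpha> t' R H H' A f"
  unfolding local_iso_def by (blast intro: closed_upto_mono)

definition finite_uniform :: "nat \<Rightarrow> 'a hypergraph \<Rightarrow> bool" where
  "finite_uniform s H \<longleftrightarrow> finite (fst H) \<and> uniform_hypergraph s H"

lemma finite_uniform_almost_surely: "holds_almost_surely s p (finite_uniform s)"
proof (rule holds_almost_surely_always)
  fix n H assume "H \<in> set_pmf (random_hypergraph s n (p n))"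
  then obtain F where "H = ({1..n}, F)" "F \<in> set_pmf (random_subset (possible_edges s {1..n}) (p n))"
    unfolding random_hypergraph_eq by auto
  moreover then have "F \<subseteq> possible_edges s {1..n}" using set_random_subset by blast
  ultimately show "finite_uniform s H" unfolding finite_uniform_def uniform_hypergraph_def by simp
qed

text \<open>The part of \<open>Z\<close> inside the image of \<open>U\<close> pulls back to
  \<open>H\<close>, where \<open>C\<close> is closed; the rest is controlled by submodularity
  against the closed image of \<open>U\<close>.\<close>

lemma closed_upto_of_superset:
  assumes \<alpha>: "\<alpha> \<ge> 0" and g: "inj_on g U" "g ` U \<subseteq> fst H'" and U: "finite U" "U \<subseteq> fst H" and C: "C \<subseteq> U"
    and edges: "\<And>e. e \<subseteq> U \<Longrightarrow> e \<in> snd H \<longleftrightarrow> g ` e \<in> snd H'"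
    and cl: "closed_upto \<alpha> t H' (g ` U)" "closed_upto \<alpha> t H C"
  shows "closed_upto \<alpha> t H' (g ` C)"
  unfolding closed_upto_def
proof (intro allI impI)
  let ?f = "predim \<alpha> (snd H')"
  fix Z assume Z: "Z \<subseteq> fst H' \<and> finite Z \<and> card Z \<le> t"
  obtain Y where Y: "Y \<subseteq> U" "Z \<inter> g ` U = g ` Y" by (metis Int_lower2 subset_image_iff)
  have finY: "finite Y" using Y(1) U(1) finite_subset by blast
  have "card Y = card (Z \<inter> g ` U)"
    unfolding Y(2) using card_image[OF inj_on_subset[OF g(1) Y(1)]] by simp
  also have "\<dots> \<le> t" using Z card_mono[of Z "Z \<inter> g ` U"] by simp
  finally have "predim \<alpha> (snd H) C \<le> predim \<alpha> (snd H) (C \<union> Y)"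
    using cl(2) Y(1) U(2) finY unfolding closed_upto_def by (meson subset_trans)
  moreover have "predim \<alpha> (snd H) C = ?f (g ` C)" "predim \<alpha> (snd H) (C \<union> Y) = ?f (g ` (C \<union> Y))"
    using C Y(1) by (intro predim_image[symmetric, OF g(1) _ edges]; simp)+
  ultimately have 1: "?f (g ` C) \<le> ?f (g ` C \<union> (Z \<inter> g ` U))" unfolding Y(2) by (simp add: image_Un)
  have 2: "?f (g ` U) \<le> ?f (g ` U \<union> Z)" using cl(1) Z unfolding closed_upto_def by blast
  have "?f ((g ` C \<union> Z) \<union> g ` U) + ?f ((g ` C \<union> Z) \<inter> g ` U) \<le> ?f (g ` C \<union> Z) + ?f (g ` U)"
    using Z U(1) finite_subset[OF C U(1)] \<alpha> by (intro predim_submodular) auto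
  moreover have "(g ` C \<union> Z) \<union> g ` U = g ` U \<union> Z" "(g ` C \<union> Z) \<inter> g ` U = g ` C \<union> (Z \<inter> g ` U)"
    using C by auto
  ultimately show "?f (g ` C) \<le> ?f (g ` C \<union> Z)" using 1 2 by simp
qed

text \<open>View \<open>A \<union> C\<close> as an extension pattern over \<open>A\<close>. As
  \<open>A\<close> is closed, no partial extension loses predimension, and irrationality makes the
  gain positive, so richness of \<open>H'\<close> provides an exact closed copy over the image of
  \<open>A\<close>. Restricting it to \<open>C\<close> replaces the size bound \<open>R\<close> by
  \<open>\<kappa>\<close>.\<close>

lemma extend_local_iso:
  assumes \<alpha>: "\<alpha> > 0" "\<alpha> \<notin> \<rat>"
    and H: "uniform_hypergraph s H"
    and iso: "local_iso \<alpha> T R H H' A f"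
    and C: "C \<subseteq> fst H" "finite C" "card C \<le> \<kappa>" "closed_upto \<alpha> t H C"
    and T: "\<kappa> + t \<le> T" and rich: "rich \<alpha> s (R + \<kappa>) t T H'"
  obtains g where "local_iso \<alpha> t \<kappa> H H' C g" "\<And>x. x \<in> A \<inter> C \<Longrightarrow> g x = f x"
proof -
  have A: "finite A" "card A \<le> R" "A \<subseteq> fst H" "closed_upto \<alpha> T H A" "inj_on f A" "f ` A \<subseteq> fst H'"
      "closed_upto \<alpha> T H' (f ` A)" and Aedges: "\<And>e. e \<subseteq> A \<Longrightarrow> e \<in> snd H \<longleftrightarrow> f ` e \<in> snd H'"
    using iso unfolding local_iso_def by auto
  define U where "U = A \<union> C"
  define m where "m = card U"
  have finU: "finite U" unfolding U_def using A(1) C(2) by simp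
  have m: "m \<le> R + \<kappa>" unfolding m_def U_def using card_Un_le[of A C] A(2) C(3) by linarith
  have mA: "m - card A \<le> \<kappa>" unfolding m_def U_def using card_Un_le[of A C] C(3) by linarith
  obtain \<phi> where \<phi>: "bij_betw \<phi> {..<m} U"
    using ex_bij_betw_nat_finite[OF finU] unfolding m_def atLeast0LessThan by blast
  have inj\<phi>: "inj_on \<phi> {..<m}" and im\<phi>: "\<phi> ` {..<m} = U" using \<phi> by (auto simp: bij_betw_def)
  define A0 where "A0 = {i \<in> {..<m}. \<phi> i \<in> A}"
  have A0: "A0 \<subseteq> {..<m}" "\<phi> ` A0 = A" unfolding A0_def using im\<phi> U_def by auto
  have sub_iff: "e \<subseteq> A0 \<longleftrightarrow> \<phi> ` e \<subseteq> A" if "e \<subseteq> {..<m}" for e using that unfolding A0_def by auto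
  have cardA0: "card A0 = card A" using card_image[OF inj_on_subset[OF inj\<phi> A0(1)]] A0(2) by simp
  \<comment> \<open>The pattern is transported to \<open>{..<m}\<close> along the enumeration
    \<open>\<phi>\<close>; as \<open>H\<close> is uniform, admitting only sets of size
    \<open>s\<close> loses no edge.\<close>
  define E0 where "E0 = {e \<in> possible_edges s {..<m}. \<phi> ` e \<in> snd H}"
  have E0: "e \<in> E0 \<longleftrightarrow> \<phi> ` e \<in> snd H" if "e \<subseteq> {..<m}" for e
  proof -
    have "card (\<phi> ` e) = card e" using that inj\<phi> by (meson card_image inj_on_subset)
    then show ?thesis using that H finite_subset[OF that]
      unfolding E0_def uniform_hypergraph_def possible_edges_def by auto
  qed
  have safe: "predim \<alpha> E0 A0 < predim \<alpha> E0 S" if S: "A0 \<subset> S" "S \<subseteq> {..<m}" for S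
  proof -
    have AS: "A \<subseteq> \<phi> ` S" using S(1) A0(2) by blast
    have finS: "finite (\<phi> ` S)" using S(2) finite_subset by blast
    have SU: "\<phi> ` S \<subseteq> U" using S(2) im\<phi> by blast
    have "\<phi> ` S - A \<subseteq> C" using SU unfolding U_def by auto
    then have "card (\<phi> ` S - A) \<le> card C" by (rule card_mono[OF C(2)])
    then have "card (\<phi> ` S - A) \<le> T" using C(3) T by linarith
    moreover have "\<phi> ` S - A \<subseteq> fst H" using SU A(3) C(1) unfolding U_def by auto
    ultimately have "predim \<alpha> (snd H) A \<le> predim \<alpha> (snd H) (A \<union> (\<phi> ` S - A))"
      using A(4) finS unfolding closed_upto_def by (meson finite_Diff)
    moreover have "A \<union> (\<phi> ` S - A) = \<phi> ` S" using AS by auto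
    moreover have "predim \<alpha> (snd H) (\<phi> ` S) - predim \<alpha> (snd H) A \<noteq> 0"
    proof
      assume "predim \<alpha> (snd H) (\<phi> ` S) - predim \<alpha> (snd H) A = 0"
      then have "card (\<phi> ` S - A) = 0"
        unfolding predim_diff[OF AS finS] by (rule irrational_no_zero[OF \<alpha>(2)])
      then have "\<phi> ` S \<subseteq> A" using finS by auto
      then show False using sub_iff[OF S(2)] S(1) by auto
    qed
    ultimately have "predim \<alpha> (snd H) (\<phi> ` A0) < predim \<alpha> (snd H) (\<phi> ` S)" unfolding A0(2) by simp
    then show ?thesis
      using predim_image[OF inj\<phi> A0(1) E0] predim_image[OF inj\<phi> S(2) E0] by simp
  qed
  have "generic_extensions \<alpha> t T A0 {..<m} E0 H'"
    using rich unfolding rich_def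
  proof (elim allE impE)
    show "m \<le> R + \<kappa> \<and> A0 \<subseteq> {..<m} \<and> E0 \<subseteq> possible_edges s {..<m} \<and> m - card A0 + t \<le> T \<and>
        (\<forall>S. A0 \<subset> S \<longrightarrow> S \<subseteq> {..<m} \<longrightarrow> predim \<alpha> E0 A0 < predim \<alpha> E0 S)"
      using m A0(1) mA T safe cardA0 unfolding E0_def by auto
  qed
  moreover have "inj_on (f \<circ> \<phi>) A0"
    using inj_on_subset[OF inj\<phi> A0(1)] A(5) A0(2) by (simp add: comp_inj_on)
  moreover have imf: "(f \<circ> \<phi>) ` A0 = f ` A" using A0(2) by (metis image_comp)
  ultimately obtain h where "exact_extension \<alpha> t A0 {..<m} E0 H' (f \<circ> \<phi>) h"
    using A(6,7) unfolding generic_extensions_def by metis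
  then have h: "inj_on h {..<m}" "h ` {..<m} \<subseteq> fst H'" "\<And>a. a \<in> A0 \<Longrightarrow> h a = f (\<phi> a)"
      "closed_upto \<alpha> t H' (h ` {..<m})"
      and hedges: "\<And>e. e \<subseteq> {..<m} \<Longrightarrow> \<not> e \<subseteq> A0 \<Longrightarrow> h ` e \<in> snd H' \<longleftrightarrow> e \<in> E0"
    unfolding exact_extension_def by auto
  define g where "g = h \<circ> inv_into {..<m} \<phi>"
  have g\<phi>: "g (\<phi> i) = h i" if "i < m" for i unfolding g_def using that inj\<phi> by simp
  have g\<phi>i: "g ` \<phi> ` e = h ` e" if "e \<subseteq> {..<m}" for e
    using that g\<phi> by (force simp: image_image)
  have gU: "g ` U = h ` {..<m}" using g\<phi>i[of "{..<m}"] im\<phi> by simp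
  have gA: "g x = f x" if x: "x \<in> A" for x
  proof -
    obtain i where "i \<in> A0" "x = \<phi> i" using x A0(2) by blast
    then show ?thesis using g\<phi>[of i] h(3) A0(1) by auto
  qed
  have injg: "inj_on g U"
    unfolding g_def im\<phi>[symmetric]
    by (rule comp_inj_on) (simp_all add: h(1) inj\<phi> inj_on_inv_into)
  have gedges: "e \<in> snd H \<longleftrightarrow> g ` e \<in> snd H'" if e: "e \<subseteq> U" for e
  proof -
    obtain e0 where e0: "e0 \<subseteq> {..<m}" "e = \<phi> ` e0" using e unfolding im\<phi>[symmetric] by (auto simp: subset_image_iff)
    \<comment> \<open>Exactness says nothing about edges inside \<open>A\<close>; there
      \<open>g\<close> coincides with \<open>f\<close>, which preserves edges by assumption.\<close>
    show ?thesis
    proof (cases "e \<subseteq> A")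
      case True
      then have "g ` e = f ` e" using gA by (auto intro!: image_cong)
      then show ?thesis using Aedges[OF True] by simp
    next
      case False
      then have "\<not> e0 \<subseteq> A0" using sub_iff[OF e0(1)] e0(2) by simp
      then show ?thesis using hedges[OF e0(1)] E0[OF e0(1)] g\<phi>i[OF e0(1)] e0(2) by simp
    qed
  qed
  have CU: "C \<subseteq> U" unfolding U_def by simp
  have "closed_upto \<alpha> t H' (g ` C)"
    by (rule closed_upto_of_superset[OF _ injg _ finU _ CU gedges])
      (use \<alpha>(1) gU h(2,4) A(3) C U_def in auto)
  moreover have "g ` C \<subseteq> fst H'" using CU gU h(2) by blast
  ultimately have "local_iso \<alpha> t \<kappa> H H' C g"
    unfolding local_iso_def using C inj_on_subset[OF injg CU] gedges CU by blast
  then show thesis using gA that by blast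
qed

section \<open>Truth of formulas under local isomorphisms\<close>

lemma finite_free_vars: "finite (free_vars \<phi>)"
  by (induction \<phi>) auto

text \<open>\<open>Q\<close> stands for a property that holds almost surely. \<open>H\<close> and
  \<open>H'\<close> range independently over the hypergraphs with this property, possibly with
  different numbers of vertices, which is what lets \<open>Q\<close> decide the truth of a
  sentence.\<close>

definition agrees :: "real \<Rightarrow> nat \<Rightarrow> nat \<Rightarrow> (nat hypergraph \<Rightarrow> bool) \<Rightarrow> fo_formula \<Rightarrow> bool" where
  "agrees \<alpha> T R Q \<phi> \<longleftrightarrow>
     (\<forall>H H' A f v w. Q H \<longrightarrow> Q H' \<longrightarrow> local_iso \<alpha> T R H H' A f \<longrightarrow>
        (\<forall>x\<in>free_vars \<phi>. v x \<in> A \<and> w x = f (v x)) \<longrightarrow> (satisfies H v \<phi> \<longleftrightarrow> satisfies H' w \<phi>))"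

lemma agreesI:
  assumes "\<And>H H' A f v w. Q H \<Longrightarrow> Q H' \<Longrightarrow> local_iso \<alpha> T R H H' A f \<Longrightarrow>
    (\<And>x. x \<in> free_vars \<phi> \<Longrightarrow> v x \<in> A) \<Longrightarrow> (\<And>x. x \<in> free_vars \<phi> \<Longrightarrow> w x = f (v x)) \<Longrightarrow>
    satisfies H v \<phi> \<longleftrightarrow> satisfies H' w \<phi>"
  shows "agrees \<alpha> T R Q \<phi>"
  unfolding agrees_def by (intro allI impI assms) auto

lemma agreesD:
  assumes "agrees \<alpha> T R Q \<phi>" "Q H" "Q H'" "local_iso \<alpha> T R H H' A f"
    "\<And>x. x \<in> free_vars \<phi> \<Longrightarrow> v x \<in> A" "\<And>x. x \<in> free_vars \<phi> \<Longrightarrow> w x = f (v x)"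
  shows "satisfies H v \<phi> \<longleftrightarrow> satisfies H' w \<phi>"
proof -
  have "\<forall>x\<in>free_vars \<phi>. v x \<in> A \<and> w x = f (v x)" using assms(5,6) by simp
  then show ?thesis using assms(1-4) unfolding agrees_def by blast
qed

text \<open>The closedness \<open>T\<close> is chosen before the bound \<open>R\<close> on the size of the matched sets: after a
  move only the closure of the finitely many relevant vertices is kept, and its size does
  not depend on the set matched before.\<close>

lemma almost_sure_agreement:
  assumes \<alpha>: "\<alpha> > 0" "\<alpha> \<notin> \<rat>" and s: "s > 0"
  shows "\<exists>T. \<forall>R. \<exists>Q. holds_almost_surely s (\<lambda>n. real n powr (- \<alpha>)) Q \<and> agrees \<alpha> T R Q \<phi>"
proof (induction \<phi>)
  case (Equal x y)
  have "agrees \<alpha> 0 R (\<lambda>_. True) (Equal x y)" for R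
  proof (rule agreesI)
    fix H H' A f v w
    assume iso: "local_iso \<alpha> 0 R H H' A f"
      and vw: "\<And>z. z \<in> free_vars (Equal x y) \<Longrightarrow> v z \<in> A" "\<And>z. z \<in> free_vars (Equal x y) \<Longrightarrow> w z = f (v z)"
    have "inj_on f A" using iso unfolding local_iso_def by blast
    then show "satisfies H v (Equal x y) \<longleftrightarrow> satisfies H' w (Equal x y)"
      using vw(1)[of x] vw(1)[of y] vw(2)[of x] vw(2)[of y] by (auto dest: inj_onD)
  qed
  moreover have "holds_almost_surely s (\<lambda>n. real n powr (- \<alpha>)) (\<lambda>_. True)"
    by (rule holds_almost_surely_always) simp
  ultimately show ?case by blast
next
  case (EdgeRel xs)
  have "agrees \<alpha> 0 R (\<lambda>_. True) (EdgeRel xs)" for R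
  proof (rule agreesI)
    fix H H' A f v w
    assume iso: "local_iso \<alpha> 0 R H H' A f"
      and vw: "\<And>z. z \<in> free_vars (EdgeRel xs) \<Longrightarrow> v z \<in> A" "\<And>z. z \<in> free_vars (EdgeRel xs) \<Longrightarrow> w z = f (v z)"
    have w: "map w xs = map f (map v xs)" using vw(2) by simp
    have sub: "set (map v xs) \<subseteq> A" using vw(1) by auto
    have inj: "inj_on f A" and edges: "\<And>e. e \<subseteq> A \<Longrightarrow> e \<in> snd H \<longleftrightarrow> f ` e \<in> snd H'"
      using iso unfolding local_iso_def by auto
    have "inj_on f (set (map v xs))" by (rule inj_on_subset[OF inj sub])
    then have "distinct (map w xs) \<longleftrightarrow> distinct (map v xs)"
      unfolding w by (simp add: distinct_map del: set_map map_map)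
    moreover have "set (map w xs) \<in> snd H' \<longleftrightarrow> set (map v xs) \<in> snd H"
      unfolding w set_map[of f "map v xs"] using edges[OF sub] by (rule sym)
    ultimately show "satisfies H v (EdgeRel xs) \<longleftrightarrow> satisfies H' w (EdgeRel xs)"
      by (simp only: satisfies.simps)
  qed
  moreover have "holds_almost_surely s (\<lambda>n. real n powr (- \<alpha>)) (\<lambda>_. True)"
    by (rule holds_almost_surely_always) simp
  ultimately show ?case by blast
next
  case (Neg \<phi>)
  then show ?case by (simp add: agrees_def)
next
  case (And \<phi> \<psi>)
  obtain T1 T2 where
    1: "\<And>R. \<exists>Q. holds_almost_surely s (\<lambda>n. real n powr (- \<alpha>)) Q \<and> agrees \<alpha> T1 R Q \<phi>" and
    2: "\<And>R. \<exists>Q. holds_almost_surely s (\<lambda>n. real n powr (- \<alpha>)) Q \<and> agrees \<alpha> T2 R Q \<psi>"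
    using And.IH by blast
  show ?case
  proof (intro exI[of _ "max T1 T2"] allI)
    fix R
    obtain Q1 where Q1: "holds_almost_surely s (\<lambda>n. real n powr (- \<alpha>)) Q1" "agrees \<alpha> T1 R Q1 \<phi>"
      using 1 by blast
    obtain Q2 where Q2: "holds_almost_surely s (\<lambda>n. real n powr (- \<alpha>)) Q2" "agrees \<alpha> T2 R Q2 \<psi>"
      using 2 by blast
    have "agrees \<alpha> (max T1 T2) R (\<lambda>H. Q1 H \<and> Q2 H) (And \<phi> \<psi>)"
    proof (rule agreesI)
      fix H H' A f v w
      assume *: "Q1 H \<and> Q2 H" "Q1 H' \<and> Q2 H'" "local_iso \<alpha> (max T1 T2) R H H' A f"
        "\<And>x. x \<in> free_vars (And \<phi> \<psi>) \<Longrightarrow> v x \<in> A" "\<And>x. x \<in> free_vars (And \<phi> \<psi>) \<Longrightarrow> w x = f (v x)"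
      have "satisfies H v \<phi> \<longleftrightarrow> satisfies H' w \<phi>"
        using * by (intro agreesD[OF Q1(2) _ _ local_iso_mono[OF *(3)]]) auto
      moreover have "satisfies H v \<psi> \<longleftrightarrow> satisfies H' w \<psi>"
        using * by (intro agreesD[OF Q2(2) _ _ local_iso_mono[OF *(3)]]) auto
      ultimately show "satisfies H v (And \<phi> \<psi>) \<longleftrightarrow> satisfies H' w (And \<phi> \<psi>)" by simp
    qed
    then show "\<exists>Q. holds_almost_surely s (\<lambda>n. real n powr (- \<alpha>)) Q \<and> agrees \<alpha> (max T1 T2) R Q (And \<phi> \<psi>)"
      using holds_almost_surely_conj[OF Q1(1) Q2(1)] by blast
  qed
next
  case (Exists x \<phi>)
  obtain T0 where T0: "\<And>R. \<exists>Q. holds_almost_surely s (\<lambda>n. real n powr (- \<alpha>)) Q \<and> agrees \<alpha> T0 R Q \<phi>"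
    using Exists.IH by blast
  obtain \<kappa> L where hull: "\<And>(H :: nat hypergraph) X. finite (fst H) \<Longrightarrow> X \<subseteq> fst H \<Longrightarrow>
      card X \<le> card (free_vars \<phi>) + 1 \<Longrightarrow>
       (\<And>W. W \<subseteq> fst H \<Longrightarrow> card W \<le> L \<Longrightarrow> 0 \<le> predim \<alpha> (snd H) W) \<Longrightarrow>
       \<exists>C. X \<subseteq> C \<and> C \<subseteq> fst H \<and> card C \<le> \<kappa> \<and> closed_upto \<alpha> T0 H C"
    by (rule closed_hull[OF \<alpha>(1), of "card (free_vars \<phi>) + 1" T0]) blast
  \<comment> \<open>The pattern adds at most \<open>\<kappa>\<close> vertices to the matched set and
    its copy must be closed up to \<open>T0\<close>; the sum meets the requirement
    \<open>m - card A + t \<le> T\<close> of richness.\<close>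
  define T where "T = \<kappa> + T0"
  show ?case
  proof (intro exI[of _ T] allI)
    fix R
    \<comment> \<open>The induction hypothesis is taken at size \<open>\<kappa>\<close>, because
      only the hull stays matched after the move.\<close>
    obtain Q0 where Q0: "holds_almost_surely s (\<lambda>n. real n powr (- \<alpha>)) Q0" "agrees \<alpha> T0 \<kappa> Q0 \<phi>"
      using T0 by blast
    define Q where "Q H \<longleftrightarrow> Q0 H \<and> finite_uniform s H \<and>
      (\<forall>W \<subseteq> fst H. card W \<le> L \<longrightarrow> 0 \<le> predim \<alpha> (snd H) W) \<and> rich \<alpha> s (R + \<kappa>) T0 T H" for H
    have Qas: "holds_almost_surely s (\<lambda>n. real n powr (- \<alpha>)) Q"
      unfolding Q_def
      by (intro holds_almost_surely_conj Q0(1) finite_uniform_almost_surely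
          small_sets_nonneg_predim[OF \<alpha>(1) s] rich_almost_surely[OF \<alpha>(1)])
    \<comment> \<open>Only one direction is proved; the converse follows by applying it to the
      inverse local isomorphism.\<close>
    have forth: "satisfies H' w (Exists x \<phi>)"
      if Q: "Q H" "Q H'" and iso: "local_iso \<alpha> T R H H' A f"
        and v: "\<And>y. y \<in> free_vars (Exists x \<phi>) \<Longrightarrow> v y \<in> A"
        and w: "\<And>y. y \<in> free_vars (Exists x \<phi>) \<Longrightarrow> w y = f (v y)"
        and sat: "satisfies H v (Exists x \<phi>)" for H H' A f v w
    proof -
      obtain a where a: "a \<in> fst H" "satisfies H (v(x := a)) \<phi>" using sat by auto
      have AH: "A \<subseteq> fst H" using iso unfolding local_iso_def by blast
      have H: "finite (fst H)" "uniform_hypergraph s H"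
          "\<And>W. W \<subseteq> fst H \<Longrightarrow> card W \<le> L \<Longrightarrow> 0 \<le> predim \<alpha> (snd H) W"
        using Q(1) unfolding Q_def finite_uniform_def by auto
      have H': "rich \<alpha> s (R + \<kappa>) T0 T H'" using Q(2) unfolding Q_def by blast
      \<comment> \<open>Inserting \<open>a\<close> separately covers the case that \<open>x\<close>
        is not free in \<open>\<phi>\<close>, so that \<open>g a\<close> is still known to be a
        vertex of \<open>H'\<close>.\<close>
      define X where "X = insert a ((v(x := a)) ` free_vars \<phi>)"
      have XH: "X \<subseteq> fst H" unfolding X_def using a(1) v AH by auto
      have "card X \<le> Suc (card ((v(x := a)) ` free_vars \<phi>))" unfolding X_def by (rule card_insert_le_m1) simp_all
      also have "\<dots> \<le> card (free_vars \<phi>) + 1"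
        using card_image_le[OF finite_free_vars, of "v(x := a)" \<phi>] by linarith
      finally obtain C where C: "X \<subseteq> C" "C \<subseteq> fst H" "card C \<le> \<kappa>" "closed_upto \<alpha> T0 H C"
        using hull[OF H(1) XH _ H(3)] by blast
      have finC: "finite C" using C(2) H(1) finite_subset by blast
      obtain g where g: "local_iso \<alpha> T0 \<kappa> H H' C g" "\<And>x. x \<in> A \<inter> C \<Longrightarrow> g x = f x"
        by (rule extend_local_iso[OF \<alpha> H(2) iso C(2) finC C(3,4) _ H']) (auto simp: T_def)
      have "satisfies H (v(x := a)) \<phi> \<longleftrightarrow> satisfies H' (w(x := g a)) \<phi>"
      proof (rule agreesD[OF Q0(2) _ _ g(1)])
        fix y assume y: "y \<in> free_vars \<phi>"
        show yC: "(v(x := a)) y \<in> C" using y C(1) unfolding X_def by blast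
        \<comment> \<open>For a variable other than \<open>x\<close> the old value lies in
          \<open>A \<inter> C\<close>, where \<open>g\<close> agrees with \<open>f\<close>.\<close>
        show "(w(x := g a)) y = g ((v(x := a)) y)"
          using yC g(2)[of "v y"] v[of y] w[of y] y by (cases "y = x") auto
      qed (use Q in \<open>simp_all add: Q_def\<close>)
      moreover have "g a \<in> fst H'" using g(1) C(1) unfolding local_iso_def X_def by blast
      ultimately show ?thesis using a(2) by auto
    qed
    have "agrees \<alpha> T R Q (Exists x \<phi>)"
    proof (rule agreesI)
      fix H H' A f v w
      assume *: "Q H" "Q H'" "local_iso \<alpha> T R H H' A f"
        "\<And>y. y \<in> free_vars (Exists x \<phi>) \<Longrightarrow> v y \<in> A" "\<And>y. y \<in> free_vars (Exists x \<phi>) \<Longrightarrow> w y = f (v y)"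
      have inj: "inj_on f A" using *(3) unfolding local_iso_def by blast
      have "w y \<in> f ` A" "v y = inv_into A f (w y)" if "y \<in> free_vars (Exists x \<phi>)" for y
        using *(4)[OF that] *(5)[OF that] inj by auto
      then have "satisfies H' w (Exists x \<phi>) \<Longrightarrow> satisfies H v (Exists x \<phi>)"
        by (rule forth[OF *(2,1) local_iso_sym[OF *(3)]])
      then show "satisfies H v (Exists x \<phi>) \<longleftrightarrow> satisfies H' w (Exists x \<phi>)"
        using forth[OF *] by (rule iffI[rotated])
    qed
    then show "\<exists>Q. holds_almost_surely s (\<lambda>n. real n powr (- \<alpha>)) Q \<and> agrees \<alpha> T R Q (Exists x \<phi>)"
      using Qas by blast
  qed
qed

theorem theorem8:
  fixes s :: nat and \<alpha> :: real
  assumes "s \<ge> 2" and "\<alpha> > 0" and "\<alpha> \<notin> \<rat>"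
  shows "zero_one_law s (\<lambda>n. real n powr (- \<alpha>))"
  unfolding zero_one_law_def
proof (intro allI impI)
  let ?p = "\<lambda>n. real n powr (- \<alpha>)"
  fix P :: "nat hypergraph \<Rightarrow> bool"
  assume "first_order_property s P"
  then obtain \<phi> where \<phi>: "free_vars \<phi> = {}" "\<And>H. uniform_hypergraph s H \<Longrightarrow> P H \<longleftrightarrow> models H \<phi>"
    unfolding first_order_property_def fo_sentence_def by blast
  have s: "s > 0" using assms(1) by simp
  obtain T where T: "\<And>R. \<exists>Q. holds_almost_surely s ?p Q \<and> agrees \<alpha> T R Q \<phi>"
    using almost_sure_agreement[OF assms(2,3) s, of \<phi>] by blast
  \<comment> \<open>Size \<open>0\<close> suffices: a sentence has no free variables, so the back
    and forth can start from the empty map.\<close>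
  obtain Q0 where Q0: "holds_almost_surely s ?p Q0" "agrees \<alpha> T 0 Q0 \<phi>"
    using T by blast
  define Q where "Q H \<longleftrightarrow> Q0 H \<and> finite_uniform s H \<and>
      (\<forall>W \<subseteq> fst H. card W \<le> T \<longrightarrow> 0 \<le> predim \<alpha> (snd H) W)" for H
  have Q: "holds_almost_surely s ?p Q"
    unfolding Q_def
    by (intro holds_almost_surely_conj Q0(1) finite_uniform_almost_surely small_sets_nonneg_predim[OF assms(2) s])
  \<comment> \<open>The empty set is not an edge and has predimension \<open>0\<close>, while small
    sets have nonnegative predimension, so it is closed. These facts make the empty map a local
    isomorphism.\<close>
  have closed: "closed_upto \<alpha> T H {}" and noedge: "{} \<notin> snd H" if "Q H" for H
  proof -
    have "snd H \<subseteq> possible_edges s (fst H)" using that unfolding Q_def finite_uniform_def uniform_hypergraph_def by blast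
    then have "predim \<alpha> (snd H) {} = 0" "{} \<notin> snd H"
      using predim_empty[OF s] s by (auto simp: possible_edges_def)
    then show "closed_upto \<alpha> T H {}" "{} \<notin> snd H"
      using that unfolding closed_upto_def Q_def by simp_all
  qed
  have agree: "P H \<longleftrightarrow> P H'" if H: "Q H" "Q H'" for H H'
  proof -
    have "local_iso \<alpha> T 0 H H' {} id"
      using closed[OF H(1)] closed[OF H(2)] noedge[OF H(1)] noedge[OF H(2)]
      unfolding local_iso_def by simp
    then have "satisfies H v \<phi> \<longleftrightarrow> satisfies H' v \<phi>" for v
      by (rule agreesD[OF Q0(2), rotated 2]) (use H \<phi>(1) in \<open>simp_all add: Q_def\<close>)
    then show ?thesis
      using H \<phi>(2) models_iff_satisfies[OF \<phi>(1)] unfolding Q_def finite_uniform_def by blast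
  qed
  \<comment> \<open>All hypergraphs with \<open>Q\<close> agree on \<open>P\<close>, and
    \<open>Q\<close> holds almost surely: if one of them has \<open>P\<close>, then \<open>P\<close>
    holds almost surely, and otherwise almost never.\<close>
  show "holds_almost_surely s ?p P \<or> holds_almost_never s ?p P"
  proof (cases "\<exists>H. Q H \<and> P H")
    case True
    then have "holds_almost_surely s ?p P"
      using agree by (intro holds_almost_surely_mono[OF Q]) blast
    then show ?thesis ..
  next
    case False
    then have "holds_almost_surely s ?p (\<lambda>H. \<not> P H)"
      by (intro holds_almost_surely_mono[OF Q]) blast
    then show ?thesis
      unfolding holds_almost_surely_iff[of s ?p "\<lambda>H. \<not> P H"] holds_almost_never_def by simp
  qed
qed

end
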